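(* Let $0\leq\lambda\leq 1$ and let $M$ be a compact $\lambda$-translator with density vector $\mathbf{w}\in\mathbb{S}^2$ whose boundary is contained in a plane $\Pi=v^\perp$, $v\in\mathbb{S}^2$. If $|\langle v,\mathbf{w}\rangle|\geq\lambda$, then $$\mathrm{int}(M)\subset\{x\in\mathbb{R}^3:\mathrm{sign}(\langle v,\mathbf{w}\rangle)\,\langle x,v\rangle\leq 0\}.$$ Moreover, $\mathrm{int}(M)\cap\Pi\neq\emptyset$ if and only if $M$ is planar and $|\langle v,\mathbf{w}\rangle|=\lambda$.
   Context: $\mathbb{S}^2$ is the unit sphere of $\mathbb{R}^3$, $\langle\cdot,\cdot\rangle$ the Euclidean metric, and $v^\perp=\{x\in\mathbb{R}^3:\langle x,v\rangle=0\}$. Surfaces are smooth, connected and oriented, immersed in $\mathbb{R}^3$, possibly with boundary, with Gauss map (unit normal field) $N:M\to\mathbb{S}^2$; $\mathrm{int}(M)=M\setminus\partial M$. The mean curvature $H_M$ is the average of the principal curvatures with respect to $N$, with the sign convention that the graph of $u$ oriented by $N=(-Du,1)/\sqrt{1+|Du|^2}$ has $2H_M=\mathrm{div}\big(Du/\sqrt{1+|Du|^2}\big)$ (so a unit sphere with inward normal has $H_M=1$). For $\lambda\in\mathbb{R}$ and $\mathbf{w}\in\mathbb{S}^2$, a $\lambda$-translator with density vector $\mathbf{w}$ is a surface $M$ with $H_M(p)=\langle N_p,\mathbf{w}\rangle+\lambda$ for all $p\in M$. $M$ is planar if it is contained in a plane. *)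

theory Defs
  imports "HOL-Analysis.Analysis"
begin

section \<open>Smooth maps\<close>

text \<open>\<open>Ck_on_open k f S\<close> expresses that \<open>f\<close> is of class $C^k$ on \<open>S\<close>; it is only meant for open \<open>S\<close>
  and finite-dimensional domains, where it suffices to control all directional derivatives.\<close>

primrec Ck_on_open ::
    "nat \<Rightarrow> ('a::euclidean_space \<Rightarrow> 'b::real_normed_vector) \<Rightarrow> 'a set \<Rightarrow> bool" where
  "Ck_on_open 0 f S \<longleftrightarrow> continuous_on S f"
| "Ck_on_open (Suc k) f S \<longleftrightarrow>
     f differentiable_on S \<and> (\<forall>v. Ck_on_open k (\<lambda>x. frechet_derivative f (at x) v) S)"

text \<open>On an arbitrary set (here: relatively open subsets of a half-plane) smoothness means having,
  near each point, a smooth extension to an open subset of the ambient space.\<close>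

definition smooth_on :: "'a set \<Rightarrow> ('a::euclidean_space \<Rightarrow> 'b::real_normed_vector) \<Rightarrow> bool" where
  "smooth_on S f \<longleftrightarrow>
     (\<forall>x\<in>S. \<exists>T g. open T \<and> x \<in> T \<and> (\<forall>k. Ck_on_open k g T) \<and> (\<forall>y\<in>S \<inter> T. f y = g y))"


section \<open>Smooth surfaces with boundary\<close>

definition half_plane :: "(real^2) set" where
  "half_plane = {x. x $ 2 \<ge> 0}"

text \<open>A chart is a pair of its domain and its coordinate map; the values of the coordinate map
  outside the domain are irrelevant.\<close>

type_synonym 'a chart = "'a set \<times> ('a \<Rightarrow> real^2)"

definition is_chart :: "'a topology \<Rightarrow> 'a chart \<Rightarrow> bool" where
  "is_chart M = (\<lambda>(U, \<phi>). openin M U \<and> openin (top_of_set half_plane) (\<phi> ` U) \<and>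
     homeomorphic_map (subtopology M U) (top_of_set (\<phi> ` U)) \<phi>)"

definition smooth_atlas :: "'a topology \<Rightarrow> 'a chart set \<Rightarrow> bool" where
  "smooth_atlas M A \<longleftrightarrow>
     (\<forall>c\<in>A. is_chart M c) \<and> (\<Union>(U, \<phi>)\<in>A. U) = topspace M \<and>
     (\<forall>(U, \<phi>)\<in>A. \<forall>(V, \<eta>)\<in>A. smooth_on (\<phi> ` (U \<inter> V)) (\<eta> \<circ> inv_into U \<phi>))"

definition smooth_surface :: "'a topology \<Rightarrow> 'a chart set \<Rightarrow> bool" where
  "smooth_surface M A \<longleftrightarrow> Hausdorff_space M \<and> second_countable M \<and> smooth_atlas M A"

definition surface_boundary :: "'a chart set \<Rightarrow> 'a set" where
  "surface_boundary A = {p. \<exists>(U, \<phi>)\<in>A. p \<in> U \<and> \<phi> p $ 2 = 0}"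

definition surface_interior :: "'a topology \<Rightarrow> 'a chart set \<Rightarrow> 'a set" where
  "surface_interior M A = topspace M - surface_boundary A"

definition smooth_map :: "'a chart set \<Rightarrow> ('a \<Rightarrow> real^3) \<Rightarrow> bool" where
  "smooth_map A f \<longleftrightarrow> (\<forall>(U, \<phi>)\<in>A. smooth_on (\<phi> ` U) (f \<circ> inv_into U \<phi>))"

text \<open>The differential of \<open>f\<close> at \<open>p\<close>, the tangent space at \<open>p\<close> being identified with the
  coordinate plane by means of the chart. The derivative within a relatively open subset of the
  half-plane is unique, also at boundary points.\<close>

definition chart_diff :: "'a chart \<Rightarrow> ('a \<Rightarrow> real^3) \<Rightarrow> 'a \<Rightarrow> real^2 \<Rightarrow> real^3" where
  "chart_diff = (\<lambda>(U, \<phi>) f p. frechet_derivative (f \<circ> inv_into U \<phi>) (at (\<phi> p) within \<phi> ` U))"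


section \<open>Oriented immersed surfaces and their mean curvature\<close>

definition immersion :: "'a chart set \<Rightarrow> ('a \<Rightarrow> real^3) \<Rightarrow> bool" where
  "immersion A \<psi> \<longleftrightarrow> smooth_map A \<psi> \<and> (\<forall>c\<in>A. \<forall>p\<in>fst c. inj (chart_diff c \<psi> p))"

definition gauss_map :: "'a chart set \<Rightarrow> ('a \<Rightarrow> real^3) \<Rightarrow> ('a \<Rightarrow> real^3) \<Rightarrow> bool" where
  "gauss_map A \<psi> N \<longleftrightarrow> smooth_map A N \<and>
     (\<forall>c\<in>A. \<forall>p\<in>fst c. N p \<in> sphere 0 1 \<and> (\<forall>u. chart_diff c \<psi> p u \<bullet> N p = 0))"

text \<open>The orientation of a surface in $\mathbb{R}^3$ is given by the choice of the Gauss map.\<close>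

definition oriented_immersed_surface ::
    "'a topology \<Rightarrow> 'a chart set \<Rightarrow> ('a \<Rightarrow> real^3) \<Rightarrow> ('a \<Rightarrow> real^3) \<Rightarrow> bool" where
  "oriented_immersed_surface M A \<psi> N \<longleftrightarrow>
     smooth_surface M A \<and> topspace M \<noteq> {} \<and> connected_space M \<and> immersion A \<psi> \<and> gauss_map A \<psi> N"

text \<open>\<open>\<kappa>\<^sub>1\<close> and \<open>\<kappa>\<^sub>2\<close> are the eigenvalues, with multiplicity, of the shape operator \<open>S\<close> determined by
  \<open>dN = - d\<psi> \<circ> S\<close>. With this sign a unit sphere with inward normal has \<open>\<kappa>\<^sub>1 = \<kappa>\<^sub>2 = 1\<close>.\<close>

definition principal_curvatures ::
    "'a chart set \<Rightarrow> ('a \<Rightarrow> real^3) \<Rightarrow> ('a \<Rightarrow> real^3) \<Rightarrow> 'a \<Rightarrow> real \<Rightarrow> real \<Rightarrow> bool" where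
  "principal_curvatures A \<psi> N p \<kappa>\<^sub>1 \<kappa>\<^sub>2 \<longleftrightarrow>
     (\<exists>c\<in>A. p \<in> fst c \<and> (\<exists>u\<^sub>1 u\<^sub>2. u\<^sub>1 \<noteq> u\<^sub>2 \<and> independent {u\<^sub>1, u\<^sub>2} \<and>
        chart_diff c N p u\<^sub>1 = - \<kappa>\<^sub>1 *\<^sub>R chart_diff c \<psi> p u\<^sub>1 \<and>
        chart_diff c N p u\<^sub>2 = - \<kappa>\<^sub>2 *\<^sub>R chart_diff c \<psi> p u\<^sub>2))"

definition mean_curvature ::
    "'a chart set \<Rightarrow> ('a \<Rightarrow> real^3) \<Rightarrow> ('a \<Rightarrow> real^3) \<Rightarrow> 'a \<Rightarrow> real" where
  "mean_curvature A \<psi> N p =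
     (THE H. \<exists>\<kappa>\<^sub>1 \<kappa>\<^sub>2. principal_curvatures A \<psi> N p \<kappa>\<^sub>1 \<kappa>\<^sub>2 \<and> H = (\<kappa>\<^sub>1 + \<kappa>\<^sub>2) / 2)"

definition translator ::
    "real \<Rightarrow> real^3 \<Rightarrow> 'a topology \<Rightarrow> 'a chart set \<Rightarrow> ('a \<Rightarrow> real^3) \<Rightarrow> ('a \<Rightarrow> real^3) \<Rightarrow> bool" where
  "translator l w M A \<psi> N \<longleftrightarrow> oriented_immersed_surface M A \<psi> N \<and>
     (\<forall>p\<in>topspace M. mean_curvature A \<psi> N p = N p \<bullet> w + l)"

definition planar :: "'a topology \<Rightarrow> ('a \<Rightarrow> real^3) \<Rightarrow> bool" where
  "planar M \<psi> \<longleftrightarrow> (\<exists>n b. n \<noteq> 0 \<and> \<psi> ` topspace M \<subseteq> {x. x \<bullet> n = b})"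

end

theory Submission
  imports Defs
begin

text \<open>
  Let \<open>f = \<langle>\<psi>, v\<rangle>\<close> be the height above the plane, where \<open>v\<close> is replaced by \<open>-v\<close> if necessary so that
  \<open>\<lambda> \<le> \<langle>v, w\<rangle>\<close>. On any immersed surface \<open>\<Delta>\<psi> = 2 H N\<close>, and on a \<open>\<lambda>\<close>-translator, with \<open>\<lambda>\<close> denoted by \<open>l\<close> below,
  \<open>H = \<langle>N, w\<rangle> + \<lambda>\<close>. Decomposing \<open>w\<close> into tangential and normal parts turns this into
  \<open>\<Delta>f + 2 \<langle>w, \<nabla>f\<rangle> = 2 (\<langle>w, v\<rangle> + \<lambda> \<langle>N, v\<rangle>)\<close>, whose right-hand side is nonnegative since \<open>|\<langle>N, v\<rangle>| \<le> 1\<close>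
  and \<open>0 \<le> \<lambda> \<le> \<langle>w, v\<rangle>\<close>. Hence \<open>f\<close> obeys the strong maximum principle: if the maximum of \<open>f\<close>, which
  exists by compactness, is attained at an interior point, then \<open>f\<close> is constant on the connected
  surface.

  If it is not attained in the interior, its value is \<open>0\<close>, attained on the boundary, and \<open>f < 0\<close> in the
  interior. If \<open>f\<close> is constant, the surface lies in a plane parallel to \<open>v\<^sup>\<bottom>\<close>. A compact planar surface
  has boundary points, because a linear function that is not constant on the plane has no critical
  points on the surface and so attains its maximum on the boundary; therefore \<open>f = 0\<close>. The
  equation now reads \<open>\<langle>w, v\<rangle> = - \<lambda> \<langle>N, v\<rangle> \<le> \<lambda>\<close>, which forces \<open>\<langle>w, v\<rangle> = \<lambda>\<close>. This dichotomy
  (\<open>height_dichotomy\<close>) gives the inclusion and one half of the equivalence. For the other half, the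
  same remark on critical points (\<open>planar_boundary_in_plane\<close>) shows that a compact planar surface with
  boundary in \<open>v\<^sup>\<bottom>\<close> is contained in \<open>v\<^sup>\<bottom>\<close>.

  Three ingredients need work. The strong maximum principle for differential inequalities
  (\<open>strong_maximum_principle\<close>) is proved with the barrier of Hopf. The equation for \<open>f\<close> is derived without
  metric coefficients: at each point the Laplacian is computed, up to first-order terms, in an
  orthonormal frame of principal directions (\<open>height_equation\<close>). Such a frame exists because second
  derivatives commute, and the sum of the principal curvatures does not depend on the chart
  (\<open>mean_curvature_principal_frame\<close>). Finally, changes of charts have invertible differentials away from
  the boundary (\<open>transition\<close>), so that boundary points of one chart are boundary points of all others;
  half-balls around boundary points then carry the conclusion of the maximum principle across the
  surface (\<open>maximum_fills_half_ball\<close>).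
\<close>


section \<open>Directional derivatives and smooth functions\<close>

lemma Ck_on_open_cong:
  assumes "Ck_on_open k f S" "open S" "\<And>x. x \<in> S \<Longrightarrow> f x = g x"
  shows "Ck_on_open k g S"
  using assms
proof (induction k arbitrary: f g)
  case 0
  then show ?case by (auto cong: continuous_on_cong)
next
  case (Suc k)
  have eq: "frechet_derivative f (at x) = frechet_derivative g (at x)" if "x \<in> S" for x
  proof -
    have "(f has_derivative D) (at x) \<longleftrightarrow> (g has_derivative D) (at x)" for D
      using Suc.prems that has_derivative_transform_within_open[of f D x UNIV S g]
        has_derivative_transform_within_open[of g D x UNIV S f] by auto
    then show ?thesis
      by (simp add: frechet_derivative_def)
  qed
  have "g differentiable_on S"
    using Suc.prems by (metis Ck_on_open.simps(2) differentiable_on_def differentiable_transform_within zero_less_one)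
  moreover have "Ck_on_open k (\<lambda>x. frechet_derivative g (at x) v) S" for v
    by (rule Suc.IH[of "\<lambda>x. frechet_derivative f (at x) v"]) (use Suc.prems eq in auto)
  ultimately show ?case by simp
qed

lemma Ck_on_open_subset: "Ck_on_open k f S \<Longrightarrow> T \<subseteq> S \<Longrightarrow> Ck_on_open k f T"
  by (induction k arbitrary: f) (auto intro: continuous_on_subset differentiable_on_subset)

lemma Ck_on_open_local:
  assumes "\<And>x. x \<in> S \<Longrightarrow> \<exists>T. open T \<and> x \<in> T \<and> Ck_on_open k f T"
  shows "Ck_on_open k f S"
  using assms
proof (induction k arbitrary: f)
  case 0
  then show ?case
    by (metis Ck_on_open.simps(1) at_within_open continuous_at_imp_continuous_on continuous_on_eq_continuous_within)
next
  case (Suc k)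
  have "f differentiable_on S"
    unfolding differentiable_on_def
  proof
    fix x assume "x \<in> S"
    then obtain T where "open T" "x \<in> T" "f differentiable_on T" using Suc.prems by auto
    then show "f differentiable at x within S"
      by (meson at_within_open differentiable_at_withinI differentiable_on_def differentiable_on_eq_differentiable_at)
  qed
  moreover have "Ck_on_open k (\<lambda>x. frechet_derivative f (at x) v) S" for v
    by (rule Suc.IH) (use Suc.prems in \<open>fastforce\<close>)
  ultimately show ?case by simp
qed

text \<open>On an open subset the local extensions that witness smoothness are the function itself, so
  differentiability within a half-plane becomes ordinary differentiability away from its edge.\<close>

lemma smooth_on_imp_Ck_on_interior:
  assumes "smooth_on S f" "open T" "T \<subseteq> S"
  shows "Ck_on_open k f T"
proof (rule Ck_on_open_local)
  fix x assume "x \<in> T"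
  then obtain W g where W: "open W" "x \<in> W" "Ck_on_open k g W" "\<forall>y\<in>S \<inter> W. f y = g y"
    using assms unfolding smooth_on_def by (meson subsetD)
  have "Ck_on_open k f (W \<inter> T)"
    by (rule Ck_on_open_cong[of _ g])
       (use W assms in \<open>auto intro: Ck_on_open_subset\<close>)
  then show "\<exists>T. open T \<and> x \<in> T \<and> Ck_on_open k f T"
    using W \<open>x \<in> T\<close> assms by blast
qed

lemma smooth_on_imp_continuous_on:
  assumes "smooth_on S f"
  shows "continuous_on S f"
  unfolding continuous_on_eq_continuous_within
proof
  fix x assume "x \<in> S"
  then obtain W g where W: "open W" "x \<in> W" "Ck_on_open 0 g W" "\<forall>y\<in>S \<inter> W. f y = g y"
    using assms unfolding smooth_on_def by meson
  then have "continuous (at x within S) g"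
    by (simp add: continuous_at_imp_continuous_at_within continuous_on_eq_continuous_at)
  moreover have "eventually (\<lambda>y. g y = f y) (at x within S)"
    using W by (auto simp: eventually_at_topological)
  ultimately show "continuous (at x within S) f"
    unfolding continuous_within using W \<open>x \<in> S\<close>
    by (metis IntI filterlim_cong)
qed

text \<open>The direction is the first argument, so that iterated derivatives are obtained by iterating
  \<open>dderiv\<close>: the derivative of \<open>dderiv u f\<close> in direction \<open>a\<close> is \<open>dderiv a (dderiv u f)\<close>.\<close>

definition dderiv :: "'a::real_normed_vector \<Rightarrow> ('a \<Rightarrow> 'b::real_normed_vector) \<Rightarrow> 'a \<Rightarrow> 'b" where
  "dderiv u f = (\<lambda>x. frechet_derivative f (at x) u)"

lemma C2_derivs:
  assumes "Ck_on_open 2 f T" "open T"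
  shows "\<And>x. x \<in> T \<Longrightarrow> (f has_derivative (\<lambda>u. dderiv u f x)) (at x)"
    and "\<And>x u. x \<in> T \<Longrightarrow> (dderiv u f has_derivative (\<lambda>a. dderiv a (dderiv u f) x)) (at x)"
    and "\<And>u. continuous_on T (dderiv u f)"
    and "\<And>u a. continuous_on T (dderiv a (dderiv u f))"
proof -
  have 1: "f differentiable_on T"
    and 2: "\<And>u. dderiv u f differentiable_on T"
    and 3: "\<And>u a. continuous_on T (dderiv a (dderiv u f))"
    using assms by (auto simp: numeral_2_eq_2 dderiv_def)
  show "(f has_derivative (\<lambda>u. dderiv u f x)) (at x)" if "x \<in> T" for x
    using 1 that assms(2) by (simp add: differentiable_on_eq_differentiable_at dderiv_def frechet_derivative_works[symmetric])
  show "(dderiv u f has_derivative (\<lambda>a. dderiv a (dderiv u f) x)) (at x)" if "x \<in> T" for x u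
    using 2[of u] that assms(2)
    by (simp add: differentiable_on_eq_differentiable_at dderiv_def[of _ "dderiv u f"] frechet_derivative_works[symmetric])
  show "continuous_on T (dderiv u f)" for u
    using 2 differentiable_imp_continuous_on by blast
  show "continuous_on T (dderiv a (dderiv u f))" for u a using 3 .
qed

lemma has_derivative_along_line:
  assumes "(f has_derivative D) (at (x + t *\<^sub>R u))"
  shows "((\<lambda>t. f (x + t *\<^sub>R u)) has_real_derivative D u) (at t)"
proof -
  have "((\<lambda>t. f (x + t *\<^sub>R u)) has_derivative (\<lambda>s. D (s *\<^sub>R u))) (at t)"
    by (rule has_derivative_compose[where f="\<lambda>t. x + t *\<^sub>R u" and g=f, OF _ assms])
       (auto intro!: derivative_eq_intros)
  then show ?thesis
    using linear_scale[OF has_derivative_linear[OF assms]]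
    by (simp add: has_field_derivative_def mult_commute_abs)
qed

text \<open>Restricted to the line through \<open>y\<close> in direction \<open>u\<close>, this is the one-dimensional second derivative
  test: were the second derivative positive, the first derivative, which vanishes at \<open>y\<close>, would be
  positive just after it.\<close>

lemma second_derivative_at_maximum:
  fixes F :: "'a::real_normed_vector \<Rightarrow> real"
  assumes "open T" "y \<in> T"
    and F1: "\<And>x. x \<in> T \<Longrightarrow> (F has_derivative F1 x) (at x)"
    and F2: "((\<lambda>x. F1 x u) has_derivative F2) (at y)"
    and max: "\<And>x. x \<in> T \<Longrightarrow> F x \<le> F y"
  shows "F1 y u = 0" and "F2 u \<le> 0"
proof -
  have "\<exists>e>0. ball y e \<subseteq> T" using assms(1,2) open_contains_ball by blast
  then show z: "F1 y u = 0"
    using differential_zero_maxmin[of y T F "F1 y"] assms by (auto simp: fun_eq_iff)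
  define g where "g t = F (y + t *\<^sub>R u)" for t
  define g' where "g' t = F1 (y + t *\<^sub>R u) u" for t
  have o: "open ((\<lambda>t. y + t *\<^sub>R u) -` T)"
    by (intro open_vimage assms) (auto intro!: continuous_intros)
  have "0 \<in> (\<lambda>t. y + t *\<^sub>R u) -` T" using \<open>y \<in> T\<close> by simp
  then obtain e where e: "e > 0" "ball 0 e \<subseteq> (\<lambda>t. y + t *\<^sub>R u) -` T"
    using o open_contains_ball by blast
  then have e2: "y + t *\<^sub>R u \<in> T" if "\<bar>t\<bar> < e" for t
    using that by (auto simp: subset_iff)
  have g: "(g has_real_derivative g' t) (at t)" if "\<bar>t\<bar> < e" for t
    unfolding g_def g'_def by (rule has_derivative_along_line) (use F1 e2 that in auto)
  have g': "(g' has_real_derivative F2 u) (at 0)"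
    unfolding g'_def using has_derivative_along_line[where f="\<lambda>x. F1 x u" and x=y and t=0] F2 by auto
  show "F2 u \<le> 0"
  proof (rule ccontr)
    assume "\<not> F2 u \<le> 0"
    then obtain d where d: "d > 0" "\<And>h. 0 < h \<Longrightarrow> h < d \<Longrightarrow> g' 0 < g' (0 + h)"
      using DERIV_pos_inc_right[OF g'] by auto
    define s where "s = min d e / 2"
    have s: "s > 0" "s < d" "s < e" using d e by (auto simp: s_def min_def)
    obtain \<xi> where "0 < \<xi>" "\<xi> < s" "g s - g 0 = (s - 0) * g' \<xi>"
      using MVT2[of 0 s g g'] g s by force
    moreover have "g' \<xi> > 0" using d(2)[of \<xi>] calculation s z by (simp add: g'_def)
    ultimately have "g s > g 0" using s by (smt (verit) mult_pos_pos)
    then show False using max[of "y + s *\<^sub>R u"] e2[of s] s by (simp add: g_def)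
  qed
qed

text \<open>The second difference over a parallelogram is a difference of differences in direction \<open>u\<close>, so two
  applications of the mean value theorem, first in direction \<open>u\<close> and then in direction \<open>v\<close>, express it
  by a mixed second derivative.\<close>

lemma mixed_difference_quotient:
  fixes f :: "'a::real_normed_vector \<Rightarrow> real"
  assumes B: "\<And>s r. 0 \<le> s \<Longrightarrow> s \<le> t \<Longrightarrow> 0 \<le> r \<Longrightarrow> r \<le> t \<Longrightarrow> x + s *\<^sub>R u + r *\<^sub>R v \<in> T"
    and f1: "\<And>x. x \<in> T \<Longrightarrow> (f has_derivative f1 x) (at x)"
    and f2: "\<And>x. x \<in> T \<Longrightarrow> ((\<lambda>x. f1 x u) has_derivative f2 x) (at x)"
    and t: "0 < t"
  shows "\<exists>s r. 0 < s \<and> s < t \<and> 0 < r \<and> r < t \<and>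
    f (x + t *\<^sub>R u + t *\<^sub>R v) - f (x + t *\<^sub>R u) - f (x + t *\<^sub>R v) + f x = t * (t * f2 (x + s *\<^sub>R u + r *\<^sub>R v) v)"
proof -
  define g where "g s = f (x + t *\<^sub>R v + s *\<^sub>R u) - f (x + s *\<^sub>R u)" for s
  have "(g has_real_derivative f1 (x + t *\<^sub>R v + s *\<^sub>R u) u - f1 (x + s *\<^sub>R u) u) (at s)"
    if "0 \<le> s" "s \<le> t" for s
    unfolding g_def
    by (intro DERIV_diff has_derivative_along_line f1)
       (use B[of s t] B[of s 0] that t in \<open>auto simp: add_ac\<close>)
  then obtain s where s: "0 < s" "s < t" "g t - g 0 = (t - 0) * (f1 (x + t *\<^sub>R v + s *\<^sub>R u) u - f1 (x + s *\<^sub>R u) u)"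
    using MVT2[of 0 t g "\<lambda>s. f1 (x + t *\<^sub>R v + s *\<^sub>R u) u - f1 (x + s *\<^sub>R u) u"] t by auto
  define h where "h r = f1 (x + s *\<^sub>R u + r *\<^sub>R v) u" for r
  have "(h has_real_derivative f2 (x + s *\<^sub>R u + r *\<^sub>R v) v) (at r)" if "0 \<le> r" "r \<le> t" for r
    unfolding h_def
    by (intro has_derivative_along_line[where f="\<lambda>x. f1 x u"] f2) (use B that s in auto)
  then obtain r where "0 < r" "r < t" "h t - h 0 = (t - 0) * f2 (x + s *\<^sub>R u + r *\<^sub>R v) v"
    using MVT2[of 0 t h "\<lambda>r. f2 (x + s *\<^sub>R u + r *\<^sub>R v) v"] t by auto
  then show ?thesis using s
    by (intro exI[of _ s] exI[of _ r]) (auto simp: g_def h_def add_ac)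
qed

text \<open>The second difference over a small parallelogram does not change when \<open>u\<close> and \<open>v\<close> are exchanged,
  whereas it approximates either of the two mixed derivatives.\<close>

lemma symmetric_second_derivative_real:
  fixes f :: "'a::real_normed_vector \<Rightarrow> real"
  assumes T: "open T" "x \<in> T"
    and f1: "\<And>x. x \<in> T \<Longrightarrow> (f has_derivative f1 x) (at x)"
    and fu: "\<And>x. x \<in> T \<Longrightarrow> ((\<lambda>x. f1 x u) has_derivative fu x) (at x)"
    and fv: "\<And>x. x \<in> T \<Longrightarrow> ((\<lambda>x. f1 x v) has_derivative fv x) (at x)"
    and cu: "isCont (\<lambda>x. fu x v) x" and cv: "isCont (\<lambda>x. fv x u) x"
  shows "fu x v = fv x u"
proof -
  have "\<bar>fu x v - fv x u\<bar> \<le> e" if "e > 0" for e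
  proof -
    obtain d1 where d1: "d1 > 0" "\<And>y. dist y x < d1 \<Longrightarrow> \<bar>fu y v - fu x v\<bar> < e/2"
      using cu \<open>e > 0\<close> unfolding continuous_at_eps_delta dist_real_def by (metis half_gt_zero)
    obtain d2 where d2: "d2 > 0" "\<And>y. dist y x < d2 \<Longrightarrow> \<bar>fv y u - fv x u\<bar> < e/2"
      using cv \<open>e > 0\<close> unfolding continuous_at_eps_delta dist_real_def by (metis half_gt_zero)
    obtain d3 where d3: "d3 > 0" "ball x d3 \<subseteq> T" using T open_contains_ball by blast
    define d where "d = min d1 (min d2 d3)"
    have d: "d > 0" "d \<le> d1" "d \<le> d2" "d \<le> d3" using d1 d2 d3 by (auto simp: d_def)
    define t where "t = d / (norm u + norm v + 1)"
    have t: "t > 0" using d by (auto simp: t_def add_nonneg_pos)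
    have near: "dist (x + s *\<^sub>R u + r *\<^sub>R v) x < d" if "0 \<le> s" "s \<le> t" "0 \<le> r" "r \<le> t" for s r
    proof -
      have "dist (x + s *\<^sub>R u + r *\<^sub>R v) x = norm (s *\<^sub>R u + r *\<^sub>R v)" by (simp add: dist_norm)
      also have "\<dots> \<le> s * norm u + r * norm v"
        using norm_triangle_ineq[of "s *\<^sub>R u" "r *\<^sub>R v"] that by simp
      also have "\<dots> \<le> t * norm u + t * norm v"
        using that by (intro add_mono mult_right_mono) auto
      also have "\<dots> < t * (norm u + norm v + 1)" using t by (simp add: algebra_simps)
      also have "\<dots> = d" 
      proof -
        have "norm u + norm v + 1 \<noteq> 0" using norm_ge_zero[of u] norm_ge_zero[of v] by linarith
        then show ?thesis by (simp add: t_def)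
      qed
      finally show ?thesis .
    qed
    have inT: "x + s *\<^sub>R u + r *\<^sub>R v \<in> T" if "0 \<le> s" "s \<le> t" "0 \<le> r" "r \<le> t" for s r
      using near[OF that] d d3 by (force simp: dist_commute)
    obtain s r where 1: "0 < s" "s < t" "0 < r" "r < t"
      "f (x + t *\<^sub>R u + t *\<^sub>R v) - f (x + t *\<^sub>R u) - f (x + t *\<^sub>R v) + f x = t * (t * fu (x + s *\<^sub>R u + r *\<^sub>R v) v)"
      using mixed_difference_quotient[OF inT f1 fu t] by blast
    have inT': "x + s *\<^sub>R v + r *\<^sub>R u \<in> T" if "0 \<le> s" "s \<le> t" "0 \<le> r" "r \<le> t" for s r
      using inT[of r s] that by (simp add: add_ac)
    obtain s' r' where 2: "0 < s'" "s' < t" "0 < r'" "r' < t"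
      "f (x + t *\<^sub>R v + t *\<^sub>R u) - f (x + t *\<^sub>R v) - f (x + t *\<^sub>R u) + f x = t * (t * fv (x + s' *\<^sub>R v + r' *\<^sub>R u) u)"
      using mixed_difference_quotient[OF inT' f1 fv t] by blast
    have "t * (t * fu (x + s *\<^sub>R u + r *\<^sub>R v) v) = t * (t * fv (x + s' *\<^sub>R v + r' *\<^sub>R u) u)"
    proof -
      have "x + t *\<^sub>R v + t *\<^sub>R u = x + t *\<^sub>R u + t *\<^sub>R v" by (simp add: add_ac)
      then have "f (x + t *\<^sub>R v + t *\<^sub>R u) = f (x + t *\<^sub>R u + t *\<^sub>R v)" by (simp only:)
      then show ?thesis using 1(5) 2(5) by linarith
    qed
    moreover have "x + s' *\<^sub>R v + r' *\<^sub>R u = x + r' *\<^sub>R u + s' *\<^sub>R v" by (simp add: add_ac)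
    ultimately have "fu (x + s *\<^sub>R u + r *\<^sub>R v) v = fv (x + r' *\<^sub>R u + s' *\<^sub>R v) u" using t by simp
    moreover have "\<bar>fu (x + s *\<^sub>R u + r *\<^sub>R v) v - fu x v\<bar> < e/2"
      by (rule d1(2)) (use near[of s r] 1 d in auto)
    moreover have "\<bar>fv (x + r' *\<^sub>R u + s' *\<^sub>R v) u - fv x u\<bar> < e/2"
      by (rule d2(2)) (use near[of r' s'] 2 d in auto)
    ultimately show ?thesis by linarith
  qed
  then have "\<bar>fu x v - fv x u\<bar> \<le> 0" by (rule field_le_epsilon) simp
  then show ?thesis by simp
qed

lemma symmetric_second_derivative:
  fixes f :: "'a::euclidean_space \<Rightarrow> 'b::euclidean_space"
  assumes C2: "Ck_on_open 2 f T" and T: "open T" "x \<in> T"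
  shows "dderiv u (dderiv v f) x = dderiv v (dderiv u f) x"
proof (rule euclidean_eqI)
  fix e :: 'b assume "e \<in> Basis"
  note D = C2_derivs[OF C2 T(1)]
  show "dderiv u (dderiv v f) x \<bullet> e = dderiv v (dderiv u f) x \<bullet> e"
  proof (rule symmetric_second_derivative_real[where f="\<lambda>x. f x \<bullet> e" and ?f1.0="\<lambda>x u. dderiv u f x \<bullet> e"
        and fu="\<lambda>x a. dderiv a (dderiv v f) x \<bullet> e" and fv="\<lambda>x a. dderiv a (dderiv u f) x \<bullet> e", OF T])
    have c: "isCont (dderiv a (dderiv b f)) x" for a b
      using D(4) T by (simp add: continuous_on_eq_continuous_at)
    show "isCont (\<lambda>x. dderiv u (dderiv v f) x \<bullet> e) x" "isCont (\<lambda>x. dderiv v (dderiv u f) x \<bullet> e) x"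
      by (intro continuous_intros c)+
  qed (auto intro!: has_derivative_inner_left D)
qed

section \<open>The strong maximum principle\<close>

lemma gaussian_derivs:
  fixes q :: "'a::real_inner" and a :: real
  defines "h \<equiv> \<lambda>x. exp (- a * ((x - q) \<bullet> (x - q)))"
  shows "(h has_derivative (\<lambda>u. - 2 * a * ((x - q) \<bullet> u) * h x)) (at x)"
    and "((\<lambda>x. - 2 * a * ((x - q) \<bullet> u) * h x) has_derivative
           (\<lambda>b. (4 * a\<^sup>2 * ((x - q) \<bullet> u) * ((x - q) \<bullet> b) - 2 * a * (u \<bullet> b)) * h x)) (at x)"
proof -
  show 1: "(h has_derivative (\<lambda>u. - 2 * a * ((x - q) \<bullet> u) * h x)) (at x)" for x
    unfolding h_def
    by (rule derivative_eq_intros refl)+ (auto simp: fun_eq_iff algebra_simps inner_commute)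
  show "((\<lambda>x. - 2 * a * ((x - q) \<bullet> u) * h x) has_derivative
           (\<lambda>b. (4 * a\<^sup>2 * ((x - q) \<bullet> u) * ((x - q) \<bullet> b) - 2 * a * (u \<bullet> b)) * h x)) (at x)"
    by (rule derivative_eq_intros refl 1)+ (auto simp: fun_eq_iff algebra_simps inner_commute power2_eq_square)
qed

text \<open>The Gaussian barrier of Hopf. With \<open>\<xi> = x - q\<close>, and up to the common factor \<open>exp (- a |\<xi>|\<^sup>2)\<close>, the
  right-hand side is the trace over the frame of the second derivatives of \<open>exp (- a |\<xi>|\<^sup>2)\<close>, and the
  left-hand side is \<open>K\<close> times its first derivatives along the frame. Ellipticity makes the leading term
  quadratic in \<open>a\<close>, whereas all others are linear, so a large \<open>a\<close> decides.\<close>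

lemma gaussian_strict_subsolution:
  fixes u\<^sub>1 u\<^sub>2 \<xi> :: "'a::real_inner" and K B \<theta> R :: real
  assumes pos: "\<theta> > 0" "R > 0" "K \<ge> 0" "B \<ge> 0"
    and a: "a * (\<theta> * R\<^sup>2) > 4 * B\<^sup>2 + 12 * K * R * B" "a > 0"
    and xi: "R / 2 \<le> norm \<xi>" "norm \<xi> \<le> 3 * R"
    and u: "norm u\<^sub>1 \<le> B" "norm u\<^sub>2 \<le> B" "\<theta> * (norm \<xi>)\<^sup>2 \<le> (u\<^sub>1 \<bullet> \<xi>)\<^sup>2 + (u\<^sub>2 \<bullet> \<xi>)\<^sup>2"
  shows "K * (\<bar>2 * a * (\<xi> \<bullet> u\<^sub>1)\<bar> + \<bar>2 * a * (\<xi> \<bullet> u\<^sub>2)\<bar>)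
    < (4 * a\<^sup>2 * (\<xi> \<bullet> u\<^sub>1) * (\<xi> \<bullet> u\<^sub>1) - 2 * a * (u\<^sub>1 \<bullet> u\<^sub>1)) + (4 * a\<^sup>2 * (\<xi> \<bullet> u\<^sub>2) * (\<xi> \<bullet> u\<^sub>2) - 2 * a * (u\<^sub>2 \<bullet> u\<^sub>2))"
proof -
  have cs: "\<bar>\<xi> \<bullet> u\<bar> \<le> 3 * R * B" if "norm u \<le> B" for u
    using order_trans[OF Cauchy_Schwarz_ineq2[of \<xi> u] mult_mono[OF xi(2) that]] pos by simp
  have uu: "u \<bullet> u \<le> B\<^sup>2" if "norm u \<le> B" for u :: 'a
    using power_mono[OF that, of 2] by (simp add: dot_square_norm)
  have "(R/2)\<^sup>2 \<le> (norm \<xi>)\<^sup>2" using xi pos by (intro power_mono) auto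
  then have "\<theta> * (R\<^sup>2 / 4) \<le> \<theta> * (norm \<xi>)\<^sup>2" using pos by (intro mult_left_mono) (auto simp: power2_eq_square)
  then have low: "\<theta> * R\<^sup>2 \<le> 4 * ((\<xi> \<bullet> u\<^sub>1)\<^sup>2 + (\<xi> \<bullet> u\<^sub>2)\<^sup>2)" using u(3) by (simp add: inner_commute)
  have "K * (\<bar>\<xi> \<bullet> u\<^sub>1\<bar> + \<bar>\<xi> \<bullet> u\<^sub>2\<bar>) \<le> K * (6 * R * B)"
    using cs[OF u(1)] cs[OF u(2)] pos by (intro mult_left_mono) auto
  then have "2 * (K * (\<bar>\<xi> \<bullet> u\<^sub>1\<bar> + \<bar>\<xi> \<bullet> u\<^sub>2\<bar>)) + 2 * (u\<^sub>1 \<bullet> u\<^sub>1 + u\<^sub>2 \<bullet> u\<^sub>2) \<le> 4 * B\<^sup>2 + 12 * K * R * B"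
    using uu[OF u(1)] uu[OF u(2)] by simp
  also have "\<dots> < a * (\<theta> * R\<^sup>2)" by (rule a)
  also have "\<dots> \<le> a * (4 * ((\<xi> \<bullet> u\<^sub>1)\<^sup>2 + (\<xi> \<bullet> u\<^sub>2)\<^sup>2))" using low a by (intro mult_left_mono) auto
  finally have "a * (2 * (K * (\<bar>\<xi> \<bullet> u\<^sub>1\<bar> + \<bar>\<xi> \<bullet> u\<^sub>2\<bar>)) + 2 * (u\<^sub>1 \<bullet> u\<^sub>1 + u\<^sub>2 \<bullet> u\<^sub>2))
     < a * (a * (4 * ((\<xi> \<bullet> u\<^sub>1)\<^sup>2 + (\<xi> \<bullet> u\<^sub>2)\<^sup>2)))" using a(2) by (rule mult_strict_left_mono)
  then show ?thesis using a(2) by (simp add: abs_mult algebra_simps power2_eq_square)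
qed

text \<open>The elliptic operator is given at each point by a pair of vectors, along which the second derivatives
  are summed; the bounds \<open>\<theta>\<close> and \<open>B\<close> say that it is uniformly elliptic. The argument is that of Hopf: if \<open>f\<close>
  is not locally constant at \<open>p\<close>, there is a ball on which \<open>f < f p\<close> except at a single boundary point \<open>z\<close>
  with \<open>f z = f p\<close>. Adding a small multiple of a Gaussian centred at the centre of that ball produces a
  function with a maximum in the interior of a small ball around \<open>z\<close>, where the second derivative test
  contradicts the strict inequality satisfied by the Gaussian.\<close>

lemma strong_maximum_principle:
  fixes f :: "'a::euclidean_space \<Rightarrow> real"
  assumes T: "open T" "p \<in> T"
    and f1: "\<And>x. x \<in> T \<Longrightarrow> (f has_derivative f1 x) (at x)"
    and f2: "\<And>x u. x \<in> T \<Longrightarrow> ((\<lambda>x. f1 x u) has_derivative f2 x u) (at x)"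
    and pos: "\<theta> > 0" "K \<ge> 0" "B \<ge> 0"
    and ell: "\<And>x. x \<in> T \<Longrightarrow> \<exists>u\<^sub>1 u\<^sub>2. norm u\<^sub>1 \<le> B \<and> norm u\<^sub>2 \<le> B \<and>
        (\<forall>\<xi>. \<theta> * (norm \<xi>)\<^sup>2 \<le> (u\<^sub>1 \<bullet> \<xi>)\<^sup>2 + (u\<^sub>2 \<bullet> \<xi>)\<^sup>2) \<and>
        - K * (\<bar>f1 x u\<^sub>1\<bar> + \<bar>f1 x u\<^sub>2\<bar>) \<le> f2 x u\<^sub>1 u\<^sub>1 + f2 x u\<^sub>2 u\<^sub>2"
    and max: "\<And>x. x \<in> T \<Longrightarrow> f x \<le> f p"
  shows "\<exists>e>0. ball p e \<subseteq> T \<and> (\<forall>x\<in>ball p e. f x = f p)"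
proof (rule ccontr)
  assume neg: "\<not> ?thesis"
  obtain e where e: "e > 0" "cball p e \<subseteq> T" using T open_contains_cball by blast
  define r where "r = e / 4"
  have r: "r > 0" "4 * r = e" using e by (auto simp: r_def)
  obtain q0 where q0: "q0 \<in> ball p r" "f q0 \<noteq> f p"
  proof -
    have "ball p r \<subseteq> T" using e r by (auto simp: subset_iff)
    then show ?thesis using neg r that by blast
  qed
  have cont: "continuous_on T f"
    by (meson continuous_at_imp_continuous_on f1 has_derivative_continuous)
  define Z where "Z = {x \<in> cball p e. f x = f p}"
  have "closed Z"
    unfolding Z_def using continuous_closed_preimage_constant[of "cball p e" f "f p"] cont e
    by (auto intro: continuous_on_subset)
  moreover have "p \<in> Z" using e by (auto simp: Z_def)
  ultimately obtain z where z: "z \<in> Z" "\<And>y. y \<in> Z \<Longrightarrow> dist q0 z \<le> dist q0 y"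
    using distance_attains_inf[of Z q0] by blast
  have zq: "dist q0 z < r" using z(2)[OF \<open>p \<in> Z\<close>] q0 by (auto simp: dist_commute)
  \<comment> \<open>Halving the ball around \<open>q0\<close> that reaches out to \<open>z\<close> makes it touch the set \<open>Z\<close> at \<open>z\<close> only.\<close>
  define q where "q = (1/2) *\<^sub>R (q0 + z)"
  define R where "R = dist q0 z / 2"
  have R: "R > 0" "2 * R < r" using q0 z zq by (auto simp: R_def Z_def)
  have nq: "norm (z - q) = R" "norm (q - q0) = R"
  proof -
    have "z - q = (1/2) *\<^sub>R (z - q0)" "q - q0 = (1/2) *\<^sub>R (z - q0)"
      by (simp_all add: q_def algebra_simps flip: scaleR_add_left)
    then show "norm (z - q) = R" "norm (q - q0) = R" by (simp_all add: R_def dist_norm norm_minus_commute)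
  qed
  have pz: "dist p z < 2 * r" using dist_triangle[of p z q0] zq q0 by auto
  have touch: "f x < f p" if "norm (x - q) \<le> R" "x \<noteq> z" for x
  proof (rule ccontr)
    assume "\<not> f x < f p"
    have "dist p x \<le> dist p q0 + (dist q0 q + dist q x)"
      using dist_triangle[of p x q0] dist_triangle[of q0 x q] by linarith
    then have "dist p x < r + (R + R)" using q0 that nq by (simp add: dist_norm norm_minus_commute)
    then have xT: "x \<in> cball p e" using R r by auto
    then have "f x = f p" using \<open>\<not> f x < f p\<close> max e(2) by (meson antisym_conv2 subsetD)
    then have "x \<in> Z" using xT by (simp add: Z_def)
    then have d: "2 * R \<le> norm (x - q0)" using z(2)[OF \<open>x \<in> Z\<close>] by (simp add: R_def dist_norm norm_minus_commute)
    have "norm (x - q0) \<le> norm (x - q) + norm (q - q0)" using norm_triangle_ineq[of "x - q" "q - q0"] by simp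
    then have eqs: "norm (x - q) = R" "norm ((x - q) + (q - q0)) = norm (x - q) + norm (q - q0)"
      using d that nq by auto
    then have "norm (x - q) *\<^sub>R (q - q0) = norm (q - q0) *\<^sub>R (x - q)"
      using norm_triangle_eq by blast
    then have "R *\<^sub>R (q - q0) = R *\<^sub>R (x - q)" using eqs nq by simp
    then have "q - q0 = x - q" using R by simp
    then have "x = 2 *\<^sub>R q - q0" by (simp add: scaleR_2 algebra_simps)
    then have "x = z" by (simp add: q_def)
    with that show False by simp
  qed
  \<comment> \<open>Just beyond the threshold in \<open>gaussian_strict_subsolution\<close>.\<close>
  define a where "a = (4 * B\<^sup>2 + 12 * K * R * B + 1) / (\<theta> * R\<^sup>2)"
  have tR: "\<theta> * R\<^sup>2 > 0" using pos R by simp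
  have nn: "4 * B\<^sup>2 + 12 * K * R * B \<ge> 0" using pos R by auto
  have a: "a * (\<theta> * R\<^sup>2) > 4 * B\<^sup>2 + 12 * K * R * B" "a > 0"
    using tR nn by (auto simp: a_def)
  define h where "h x = exp (- a * ((x - q) \<bullet> (x - q)))" for x
  define h1 where "h1 x u = - 2 * a * ((x - q) \<bullet> u) * h x" for x u
  define h2 where "h2 x u b = (4 * a\<^sup>2 * ((x - q) \<bullet> u) * ((x - q) \<bullet> b) - 2 * a * (u \<bullet> b)) * h x" for x u b
  have hd: "(h has_derivative h1 x) (at x)" "((\<lambda>x. h1 x u) has_derivative h2 x u) (at x)" for x u
    using gaussian_derivs(1)[where a=a and q=q and x=x] gaussian_derivs(2)[where a=a and q=q and x=x and u=u] by (simp_all add: h_def[abs_def] h1_def[abs_def] h2_def[abs_def])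
  \<comment> \<open>Inside the ball around \<open>q\<close>, compactness keeps \<open>f\<close> below \<open>f p\<close> by a fixed amount on the sphere around
    \<open>z\<close>, which leaves room for a multiple of the Gaussian; outside it, the Gaussian is smaller than at \<open>z\<close>.\<close>
  define C where "C = sphere z (R/2) \<inter> cball q R"
  have zb: "cball z (R/2) \<subseteq> cball p e"
  proof
    fix x assume "x \<in> cball z (R/2)"
    then show "x \<in> cball p e" using dist_triangle[of p x z] pz R r by auto
  qed
  have hz: "h z = exp (- a * R\<^sup>2)" using nq by (simp add: h_def dot_square_norm)
  obtain \<epsilon> where \<epsilon>: "\<epsilon> > 0" "\<And>x. x \<in> C \<Longrightarrow> f x + \<epsilon> * h x < f p + \<epsilon> * h z"
  proof (cases "C = {}")
    case True then show ?thesis using that[of 1] by auto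
  next
    case False
    have "compact C" unfolding C_def by (intro compact_Int_closed) auto
    moreover have "continuous_on C f"
      using cont e zb by (auto intro!: continuous_on_subset[OF cont] simp: C_def subset_iff)
    ultimately obtain c where c: "c \<in> C" "\<And>x. x \<in> C \<Longrightarrow> f x \<le> f c"
      using continuous_attains_sup[of C f] False by blast
    have "f c < f p" by (rule touch) (use c R in \<open>auto simp: C_def dist_norm norm_minus_commute\<close>)
    define \<epsilon> where "\<epsilon> = (f p - f c) / 2"
    have \<epsilon>: "\<epsilon> > 0" using \<open>f c < f p\<close> by (simp add: \<epsilon>_def)
    show ?thesis
    proof (rule that[OF \<epsilon>])
      fix x assume "x \<in> C"
      have "h x \<le> 1" using a(2) by (simp add: h_def)
      then have "\<epsilon> * h x \<le> \<epsilon>" using \<epsilon> by simp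
      moreover have "\<epsilon> * h z > 0" using \<epsilon> by (simp add: h_def)
      moreover have "f x + \<epsilon> < f p" using c(2)[OF \<open>x \<in> C\<close>] \<open>f c < f p\<close> by (simp add: \<epsilon>_def field_simps)
      ultimately show "f x + \<epsilon> * h x < f p + \<epsilon> * h z" by linarith
    qed
  qed
  define F where "F x = f x + \<epsilon> * h x" for x
  have fz: "f z = f p" using z by (simp add: Z_def)
  have bd: "F x < F z" if "x \<in> sphere z (R/2)" for x
  proof (cases "norm (x - q) \<le> R")
    case True
    then have "x \<in> C" using that by (auto simp: C_def dist_norm norm_minus_commute)
    then show ?thesis using \<epsilon>(2) fz by (simp add: F_def)
  next
    case False
    then have "R\<^sup>2 < (norm (x - q))\<^sup>2" using R by (intro power_strict_mono) auto
    then have "h x < h z" unfolding hz using a(2) by (simp add: h_def dot_square_norm)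
    moreover have "f x \<le> f p" by (rule max) (use that zb e in auto)
    ultimately show ?thesis using \<epsilon>(1) fz by (simp add: F_def add_le_less_mono)
  qed
  have "continuous_on (cball z (R/2)) F"
    unfolding F_def h_def using zb e(2) by (intro continuous_intros continuous_on_subset[OF cont]) auto
  then obtain y where y: "y \<in> cball z (R/2)" "\<And>x. x \<in> cball z (R/2) \<Longrightarrow> F x \<le> F y"
    using continuous_attains_sup[of "cball z (R/2)" F] R by auto
  have yb: "y \<in> ball z (R/2)"
  proof -
    have "F z \<le> F y" by (rule y(2)) (use R in simp)
    then have "y \<notin> sphere z (R/2)" using bd[of y] by auto
    then show ?thesis using y(1) by simp
  qed
  have bT: "ball z (R/2) \<subseteq> T" using zb e(2) ball_subset_cball by blast
  have Fd: "(F has_derivative (\<lambda>u. f1 x u + \<epsilon> * h1 x u)) (at x)"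
      "((\<lambda>x. f1 x u + \<epsilon> * h1 x u) has_derivative (\<lambda>b. f2 x u b + \<epsilon> * h2 x u b)) (at x)"
    if "x \<in> ball z (R/2)" for x u
    unfolding F_def using that bT by (auto intro!: derivative_intros f1 f2 hd)
  have crit: "f1 y u + \<epsilon> * h1 y u = 0" "f2 y u u + \<epsilon> * h2 y u u \<le> 0" for u
    using second_derivative_at_maximum[of "ball z (R/2)" y F "\<lambda>x u. f1 x u + \<epsilon> * h1 x u" u "\<lambda>b. f2 y u b + \<epsilon> * h2 y u b"]
      Fd yb y(2) by auto
  have yT: "y \<in> T" using bT yb by auto
  obtain u\<^sub>1 u\<^sub>2 where u: "norm u\<^sub>1 \<le> B" "norm u\<^sub>2 \<le> B"
     "\<forall>\<xi>. \<theta> * (norm \<xi>)\<^sup>2 \<le> (u\<^sub>1 \<bullet> \<xi>)\<^sup>2 + (u\<^sub>2 \<bullet> \<xi>)\<^sup>2"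
     "- K * (\<bar>f1 y u\<^sub>1\<bar> + \<bar>f1 y u\<^sub>2\<bar>) \<le> f2 y u\<^sub>1 u\<^sub>1 + f2 y u\<^sub>2 u\<^sub>2" using ell[OF yT] by blast
  have yq: "R / 2 \<le> norm (y - q)" "norm (y - q) \<le> 3 * R"
    using norm_triangle_ineq[of "z - y" "y - q"] norm_triangle_ineq[of "y - z" "z - q"] yb nq R
    by (auto simp: dist_norm norm_minus_commute)
  have gauss: "K * (\<bar>2 * a * ((y - q) \<bullet> u\<^sub>1)\<bar> + \<bar>2 * a * ((y - q) \<bullet> u\<^sub>2)\<bar>) * h y
     < ((4 * a\<^sup>2 * ((y - q) \<bullet> u\<^sub>1) * ((y - q) \<bullet> u\<^sub>1) - 2 * a * (u\<^sub>1 \<bullet> u\<^sub>1)) + (4 * a\<^sup>2 * ((y - q) \<bullet> u\<^sub>2) * ((y - q) \<bullet> u\<^sub>2) - 2 * a * (u\<^sub>2 \<bullet> u\<^sub>2))) * h y"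
    by (intro mult_strict_right_mono gaussian_strict_subsolution[where B=B and \<theta>=\<theta> and R=R]) (use pos R a yq u in \<open>auto simp: h_def\<close>)
  have "K * (\<bar>h1 y u\<^sub>1\<bar> + \<bar>h1 y u\<^sub>2\<bar>) < h2 y u\<^sub>1 u\<^sub>1 + h2 y u\<^sub>2 u\<^sub>2"
  proof -
    have "h y > 0" by (simp add: h_def)
    then have abs_h1: "\<bar>h1 y u\<bar> = \<bar>2 * a * ((y - q) \<bullet> u)\<bar> * h y" for u by (simp add: h1_def abs_mult)
    have "K * (\<bar>h1 y u\<^sub>1\<bar> + \<bar>h1 y u\<^sub>2\<bar>) = K * (\<bar>2 * a * ((y - q) \<bullet> u\<^sub>1)\<bar> + \<bar>2 * a * ((y - q) \<bullet> u\<^sub>2)\<bar>) * h y"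
      by (simp only: abs_h1 distrib_left distrib_right mult.assoc)
    with gauss show ?thesis by (simp only: h2_def distrib_right)
  qed
  then have lt: "\<epsilon> * (K * (\<bar>h1 y u\<^sub>1\<bar> + \<bar>h1 y u\<^sub>2\<bar>)) < \<epsilon> * (h2 y u\<^sub>1 u\<^sub>1 + h2 y u\<^sub>2 u\<^sub>2)"
    using \<epsilon>(1) by simp
  have "f1 y u = - (\<epsilon> * h1 y u)" for u using crit(1)[of u] by linarith
  then have "\<bar>f1 y u\<bar> = \<epsilon> * \<bar>h1 y u\<bar>" for u using \<epsilon>(1) by (simp add: abs_mult)
  then have "- (\<epsilon> * (K * (\<bar>h1 y u\<^sub>1\<bar> + \<bar>h1 y u\<^sub>2\<bar>))) \<le> f2 y u\<^sub>1 u\<^sub>1 + f2 y u\<^sub>2 u\<^sub>2"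
    using u(4) by (simp add: algebra_simps)
  moreover have "f2 y u\<^sub>1 u\<^sub>1 + f2 y u\<^sub>2 u\<^sub>2 + \<epsilon> * (h2 y u\<^sub>1 u\<^sub>1 + h2 y u\<^sub>2 u\<^sub>2) \<le> 0"
    using crit(2)[of u\<^sub>1] crit(2)[of u\<^sub>2] by (simp add: algebra_simps)
  ultimately show False using lt by linarith
qed

section \<open>Linear algebra of the shape operator\<close>

lemma orthonormal_expansion_3:
  fixes a b n x :: "real^3"
  assumes "norm a = 1" "norm b = 1" "norm n = 1" "a \<bullet> b = 0" "a \<bullet> n = 0" "b \<bullet> n = 0"
  shows "x = (x \<bullet> a) *\<^sub>R a + (x \<bullet> b) *\<^sub>R b + (x \<bullet> n) *\<^sub>R n"
proof -
  have ne: "a \<noteq> b" "a \<noteq> n" "b \<noteq> n" "a \<noteq> 0" "b \<noteq> 0" "n \<noteq> 0" using assms by auto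
  have orth: "pairwise orthogonal {a, b, n}"
    using assms by (auto simp: pairwise_def orthogonal_def inner_commute)
  have "independent {a, b, n}"
    by (rule pairwise_orthogonal_independent[OF orth]) (use ne in auto)
  moreover have "card {a, b, n} = 3" using ne by simp
  ultimately have "x \<in> span {a, b, n}"
    using card_ge_dim_independent[of "{a,b,n}" UNIV] by auto
  then have "(\<Sum>c\<in>{a, b, n}. (x \<bullet> c) *\<^sub>R c) = x"
    using assms by (intro orthonormal_basis_expand[OF orth]) auto
  then show ?thesis using ne by (simp add: add.assoc)
qed

lemma independent_pair_trivial:
  fixes u\<^sub>1 u\<^sub>2 :: "'a::real_vector"
  assumes "u\<^sub>1 \<noteq> u\<^sub>2" "independent {u\<^sub>1, u\<^sub>2}" "a *\<^sub>R u\<^sub>1 + b *\<^sub>R u\<^sub>2 = 0"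
  shows "a = 0 \<and> b = 0"
proof -
  let ?c = "\<lambda>x. if x = u\<^sub>1 then a else b"
  have "(\<Sum>x\<in>{u\<^sub>1, u\<^sub>2}. ?c x *\<^sub>R x) = 0" using assms by simp
  then have "?c v = 0" if "v \<in> {u\<^sub>1, u\<^sub>2}" for v
    using that by (intro independentD[OF assms(2), of "{u\<^sub>1, u\<^sub>2}" ?c]) auto
  from this[of u\<^sub>1] this[of u\<^sub>2] show ?thesis using assms(1) by (simp split: if_splits)
qed

lemma independent_pairI:
  fixes u\<^sub>1 u\<^sub>2 :: "'a::real_vector"
  assumes "\<And>a b. a *\<^sub>R u\<^sub>1 + b *\<^sub>R u\<^sub>2 = 0 \<Longrightarrow> a = 0 \<and> b = 0"
  shows "u\<^sub>1 \<noteq> u\<^sub>2 \<and> independent {u\<^sub>1, u\<^sub>2}"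
proof -
  have ne: "u\<^sub>1 \<noteq> u\<^sub>2" using assms[of 1 "-1"] by auto
  moreover have "u\<^sub>2 \<noteq> 0" using assms[of 0 1] by auto
  moreover have "u\<^sub>1 \<notin> span {u\<^sub>2}"
  proof
    assume "u\<^sub>1 \<in> span {u\<^sub>2}"
    then obtain k where "u\<^sub>1 = k *\<^sub>R u\<^sub>2" by (auto simp: span_singleton)
    then show False using assms[of 1 "-k"] by simp
  qed
  ultimately show ?thesis by (simp add: independent_insert)
qed

lemma independent_pair_spans:
  fixes u\<^sub>1 u\<^sub>2 w :: "real^2"
  assumes "u\<^sub>1 \<noteq> u\<^sub>2" "independent {u\<^sub>1, u\<^sub>2}"
  obtains a b where "w = a *\<^sub>R u\<^sub>1 + b *\<^sub>R u\<^sub>2"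
proof -
  have "w \<in> span {u\<^sub>1, u\<^sub>2}"
    using card_ge_dim_independent[of "{u\<^sub>1, u\<^sub>2}" UNIV] assms by auto
  then obtain a where "w - a *\<^sub>R u\<^sub>1 \<in> span {u\<^sub>2}" by (auto simp: span_insert)
  then obtain b where "w - a *\<^sub>R u\<^sub>1 = b *\<^sub>R u\<^sub>2" by (auto simp: span_singleton)
  then show ?thesis using that[of a b] by (simp add: algebra_simps)
qed

text \<open>\<open>P = - L \<circ> S\<close> for a linear map \<open>S\<close> with eigenvectors \<open>u\<^sub>1\<close>, \<open>u\<^sub>2\<close> and also \<open>w\<^sub>1\<close>, \<open>w\<^sub>2\<close>: both sums are its trace.
  In the proof, a vector with coordinates \<open>a\<close>, \<open>b\<close> in the first basis can only be an eigenvector for an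
  eigenvalue \<open>\<kappa>\<^sub>i\<close> at which its coordinate does not vanish, and the determinant of the change of basis is
  nonzero.\<close>

lemma eigenvalue_sum_unique:
  fixes L P :: "real^2 \<Rightarrow> 'b::real_vector"
  assumes L: "linear L" "inj L" and P: "linear P"
    and u: "u\<^sub>1 \<noteq> u\<^sub>2" "independent {u\<^sub>1, u\<^sub>2}" "P u\<^sub>1 = - \<kappa>\<^sub>1 *\<^sub>R L u\<^sub>1" "P u\<^sub>2 = - \<kappa>\<^sub>2 *\<^sub>R L u\<^sub>2"
    and w: "w\<^sub>1 \<noteq> w\<^sub>2" "independent {w\<^sub>1, w\<^sub>2}" "P w\<^sub>1 = - \<mu>\<^sub>1 *\<^sub>R L w\<^sub>1" "P w\<^sub>2 = - \<mu>\<^sub>2 *\<^sub>R L w\<^sub>2"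
  shows "\<kappa>\<^sub>1 + \<kappa>\<^sub>2 = \<mu>\<^sub>1 + \<mu>\<^sub>2"
proof -
  have ev: "(\<kappa>\<^sub>1 - \<mu>) * a = 0 \<and> (\<kappa>\<^sub>2 - \<mu>) * b = 0"
    if "P (a *\<^sub>R u\<^sub>1 + b *\<^sub>R u\<^sub>2) = - \<mu> *\<^sub>R L (a *\<^sub>R u\<^sub>1 + b *\<^sub>R u\<^sub>2)" for \<mu> a b
  proof -
    have "L (((\<kappa>\<^sub>1 - \<mu>) * a) *\<^sub>R u\<^sub>1 + ((\<kappa>\<^sub>2 - \<mu>) * b) *\<^sub>R u\<^sub>2) = 0"
      using that u by (simp add: linear_add[OF L(1)] linear_scale[OF L(1)] linear_add[OF P] linear_scale[OF P] linear_diff[OF L(1)] algebra_simps)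
    then have "((\<kappa>\<^sub>1 - \<mu>) * a) *\<^sub>R u\<^sub>1 + ((\<kappa>\<^sub>2 - \<mu>) * b) *\<^sub>R u\<^sub>2 = 0"
      using L linear_injective_0[OF L(1)] by blast
    then show ?thesis by (rule independent_pair_trivial[OF u(1,2)])
  qed
  obtain a b where ab: "w\<^sub>1 = a *\<^sub>R u\<^sub>1 + b *\<^sub>R u\<^sub>2" using independent_pair_spans[OF u(1,2)] .
  obtain c d where cd: "w\<^sub>2 = c *\<^sub>R u\<^sub>1 + d *\<^sub>R u\<^sub>2" using independent_pair_spans[OF u(1,2)] .
  have 1: "(\<kappa>\<^sub>1 - \<mu>\<^sub>1) * a = 0 \<and> (\<kappa>\<^sub>2 - \<mu>\<^sub>1) * b = 0" using ev w(3) ab by simp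
  have 2: "(\<kappa>\<^sub>1 - \<mu>\<^sub>2) * c = 0 \<and> (\<kappa>\<^sub>2 - \<mu>\<^sub>2) * d = 0" using ev w(4) cd by simp
  have det: "a * d - b * c \<noteq> 0"
  proof
    assume "a * d - b * c = 0"
    then have "d *\<^sub>R w\<^sub>1 + (- b) *\<^sub>R w\<^sub>2 = 0" "c *\<^sub>R w\<^sub>1 + (- a) *\<^sub>R w\<^sub>2 = 0"
      by (simp_all add: ab cd algebra_simps flip: scaleR_add_left scaleR_diff_left)
    then have "a = 0" "b = 0" using independent_pair_trivial[OF w(1,2)] by fastforce+
    then show False using independent_pair_trivial[OF w(1,2), of 1 0] ab by simp
  qed
  show ?thesis
  proof (cases "a = 0 \<or> d = 0")
    case True
    then have "b \<noteq> 0" "c \<noteq> 0" using det by auto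
    then show ?thesis using 1 2 by simp
  next
    case False then show ?thesis using 1 2 by simp
  qed
qed

lemma orthonormal_pair_exists:
  fixes L :: "real^2 \<Rightarrow> 'b::real_inner"
  assumes L: "linear L" "inj L"
  obtains u\<^sub>1 u\<^sub>2 where "norm (L u\<^sub>1) = 1" "norm (L u\<^sub>2) = 1" "L u\<^sub>1 \<bullet> L u\<^sub>2 = 0"
proof -
  have n0: "norm (L u) \<noteq> 0" if "u \<noteq> 0" for u using that L linear_injective_0[OF L(1)] by auto
  define e1 e2 :: "real^2" where "e1 = axis 1 1" and "e2 = axis 2 1"
  define u where "u = (1 / norm (L e1)) *\<^sub>R e1"
  have "e1 \<noteq> 0" by (simp add: e1_def axis_eq_0_iff)
  then have u: "norm (L u) = 1" using n0[of e1] by (simp add: u_def linear_scale[OF L(1)])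
  define w where "w = e2 - (L e2 \<bullet> L u) *\<^sub>R u"
  have "w $ 2 = 1" by (simp add: w_def u_def e1_def e2_def axis_def)
  then have "w \<noteq> 0" by auto
  then have nw: "norm (L w) \<noteq> 0" by (rule n0)
  have "L u \<bullet> L w = 0"
    using u by (simp add: w_def linear_diff[OF L(1)] linear_scale[OF L(1)] inner_diff_right dot_square_norm inner_commute)
  then show ?thesis
    using that[of u "(1 / norm (L w)) *\<^sub>R w"] nw u by (simp add: linear_scale[OF L(1)])
qed

text \<open>Rotating an orthonormal basis by the angle \<open>t\<close> turns the off-diagonal entry of the symmetric matrix
  with rows \<open>(p, q)\<close> and \<open>(q, r)\<close> into \<open>g t\<close>; a quarter turn changes its sign, so it vanishes in between.\<close>

lemma rotation_diagonalizes:
  fixes p q r :: real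
  obtains c s where "c\<^sup>2 + s\<^sup>2 = 1" "(r - p) * (c * s) + q * (c\<^sup>2 - s\<^sup>2) = 0"
proof -
  define g where "g t = (r - p) * (cos t * sin t) + q * ((cos t)\<^sup>2 - (sin t)\<^sup>2)" for t :: real
  have c: "continuous_on {0..pi/2} g" unfolding g_def by (intro continuous_intros)
  have g: "g 0 = q" "g (pi/2) = - q" by (simp_all add: g_def)
  have "\<exists>t. 0 \<le> t \<and> t \<le> pi/2 \<and> g t = 0"
  proof (cases "q \<ge> 0")
    case True then show ?thesis using IVT2'[of g "pi/2" 0 0] c g by auto
  next
    case False then show ?thesis using IVT'[of g 0 0 "pi/2"] c g by auto
  qed
  then obtain t where "g t = 0" by blast
  then show ?thesis using that[of "cos t" "sin t"] by (simp add: g_def)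
qed

text \<open>The spectral theorem for the shape operator. \<open>L\<close> plays the part of the differential of the immersion and
  \<open>P\<close> that of the Gauss map; symmetry of the second fundamental form allows an orthonormal frame to be
  rotated into one of eigenvectors.\<close>

lemma principal_frame_exists:
  fixes L P :: "real^2 \<Rightarrow> real^3"
  assumes L: "linear L" "inj L" and P: "linear P"
    and n: "norm n = 1" "\<And>u. L u \<bullet> n = 0" "\<And>u. P u \<bullet> n = 0"
    and sym: "\<And>u v. L u \<bullet> P v = L v \<bullet> P u"
  obtains u\<^sub>1 u\<^sub>2 \<kappa>\<^sub>1 \<kappa>\<^sub>2 where "norm (L u\<^sub>1) = 1" "norm (L u\<^sub>2) = 1" "L u\<^sub>1 \<bullet> L u\<^sub>2 = 0"
    "P u\<^sub>1 = - \<kappa>\<^sub>1 *\<^sub>R L u\<^sub>1" "P u\<^sub>2 = - \<kappa>\<^sub>2 *\<^sub>R L u\<^sub>2"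
proof -
  obtain a b where ab: "norm (L a) = 1" "norm (L b) = 1" "L a \<bullet> L b = 0"
    using orthonormal_pair_exists[OF L] .
  obtain c s where cs: "c\<^sup>2 + s\<^sup>2 = 1" "(L b \<bullet> P b - L a \<bullet> P a) * (c * s) + (L a \<bullet> P b) * (c\<^sup>2 - s\<^sup>2) = 0"
    using rotation_diagonalizes .
  define u w where "u = c *\<^sub>R a + s *\<^sub>R b" and "w = (- s) *\<^sub>R a + c *\<^sub>R b"
  have Lu: "L u = c *\<^sub>R L a + s *\<^sub>R L b" "L w = (- s) *\<^sub>R L a + c *\<^sub>R L b"
    "P u = c *\<^sub>R P a + s *\<^sub>R P b" "P w = (- s) *\<^sub>R P a + c *\<^sub>R P b"
    unfolding u_def w_def using L(1) P by (simp_all only: linear_add linear_scale)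
  have aa: "L a \<bullet> L a = 1" "L b \<bullet> L b = 1" "L b \<bullet> L a = 0"
    using ab by (simp_all add: dot_square_norm inner_commute)
  have "L u \<bullet> L u = c\<^sup>2 + s\<^sup>2" "L w \<bullet> L w = c\<^sup>2 + s\<^sup>2" and uw: "L u \<bullet> L w = 0"
    by (simp_all add: Lu inner_add_left inner_add_right inner_diff_left inner_diff_right aa ab(3) power2_eq_square)
  then have nu: "norm (L u) = 1" "norm (L w) = 1" using cs by (simp_all add: norm_eq_1)
  have "L u \<bullet> P w = (L b \<bullet> P b - L a \<bullet> P a) * (c * s) + (L a \<bullet> P b) * (c\<^sup>2 - s\<^sup>2)"
    using sym[of a b] by (simp add: Lu inner_add_left inner_add_right inner_diff_left inner_diff_right power2_eq_square algebra_simps)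
  then have off: "L u \<bullet> P w = 0" "L w \<bullet> P u = 0" using cs sym[of u w] by auto
  have ex: "x = (x \<bullet> L u) *\<^sub>R L u + (x \<bullet> L w) *\<^sub>R L w + (x \<bullet> n) *\<^sub>R n" for x
    by (rule orthonormal_expansion_3) (use nu uw n in auto)
  have "P u = - (- (P u \<bullet> L u)) *\<^sub>R L u" "P w = - (- (P w \<bullet> L w)) *\<^sub>R L w"
    using ex[of "P u"] ex[of "P w"] off n(3) by (simp_all add: inner_commute)
  then show ?thesis using that nu uw by blast
qed

section \<open>Parametrized surfaces\<close>

locale surface_patch =
  fixes T :: "(real^2) set" and X N :: "real^2 \<Rightarrow> real^3"
  assumes open_domain: "open T"
    and C2_X: "Ck_on_open 2 X T" and C2_N: "Ck_on_open 2 N T"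
    and immersed: "\<And>x. x \<in> T \<Longrightarrow> inj (\<lambda>u. dderiv u X x)"
    and unit_normal: "\<And>x. x \<in> T \<Longrightarrow> norm (N x) = 1"
    and normal: "\<And>x u. x \<in> T \<Longrightarrow> dderiv u X x \<bullet> N x = 0"
begin

lemmas X_derivs = C2_derivs[OF C2_X open_domain]
lemmas N_derivs = C2_derivs[OF C2_N open_domain]

lemma linear_dX: "x \<in> T \<Longrightarrow> linear (\<lambda>u. dderiv u X x)"
  using X_derivs(1) has_derivative_linear by blast

lemma linear_dN: "x \<in> T \<Longrightarrow> linear (\<lambda>u. dderiv u N x)"
  using N_derivs(1) has_derivative_linear by blast

lemma derivative_of_constant_function:
  assumes "x \<in> T" "(g has_derivative D) (at x)" "\<And>y. y \<in> T \<Longrightarrow> g y = c"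
  shows "D u = 0"
proof -
  have "(g has_derivative (\<lambda>_. 0)) (at x)"
    by (rule has_derivative_transform_within_open[OF has_derivative_const[of c] open_domain assms(1)])
       (simp add: assms(3))
  then have "D = (\<lambda>_. 0)" using assms(2) has_derivative_unique by blast
  then show ?thesis by simp
qed

lemma dN_tangential:
  assumes "x \<in> T" shows "dderiv u N x \<bullet> N x = 0"
proof -
  have "((\<lambda>x. N x \<bullet> N x) has_derivative (\<lambda>u. N x \<bullet> dderiv u N x + dderiv u N x \<bullet> N x)) (at x)"
    by (intro has_derivative_inner N_derivs assms)
  then have "N x \<bullet> dderiv u N x + dderiv u N x \<bullet> N x = 0"
    by (rule derivative_of_constant_function[OF assms, where c=1]) (use unit_normal in \<open>simp add: dot_square_norm\<close>)
  then show ?thesis by (simp add: inner_commute)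
qed

text \<open>Differentiate the identity \<open>\<langle>X\<^sub>u, N\<rangle> = 0\<close> in direction \<open>v\<close>.\<close>

lemma second_fundamental_form:
  assumes "x \<in> T" shows "dderiv v (dderiv u X) x \<bullet> N x = - (dderiv u X x \<bullet> dderiv v N x)"
proof -
  have "((\<lambda>x. dderiv u X x \<bullet> N x) has_derivative (\<lambda>v. dderiv u X x \<bullet> dderiv v N x + dderiv v (dderiv u X) x \<bullet> N x)) (at x)"
    by (intro has_derivative_inner N_derivs X_derivs assms)
  then have "dderiv u X x \<bullet> dderiv v N x + dderiv v (dderiv u X) x \<bullet> N x = 0"
    by (rule derivative_of_constant_function[OF assms, where c=0]) (use normal in simp)
  then show ?thesis by simp
qed

lemma shape_operator_symmetric:
  assumes "x \<in> T" shows "dderiv u X x \<bullet> dderiv v N x = dderiv v X x \<bullet> dderiv u N x"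
  using second_fundamental_form[OF assms, of u v] second_fundamental_form[OF assms, of v u]
    symmetric_second_derivative[OF C2_X open_domain assms, of u v] by simp

text \<open>Orthonormality refers to the metric induced by \<open>X\<close>; in such a frame the trace of the second
  derivatives is the Laplacian of the surface up to first-order terms.\<close>

definition principal_frame :: "real^2 \<Rightarrow> real^2 \<Rightarrow> real^2 \<Rightarrow> real \<Rightarrow> real \<Rightarrow> bool" where
  "principal_frame x u\<^sub>1 u\<^sub>2 \<kappa>\<^sub>1 \<kappa>\<^sub>2 \<longleftrightarrow>
     norm (dderiv u\<^sub>1 X x) = 1 \<and> norm (dderiv u\<^sub>2 X x) = 1 \<and> dderiv u\<^sub>1 X x \<bullet> dderiv u\<^sub>2 X x = 0 \<and>
     dderiv u\<^sub>1 N x = - \<kappa>\<^sub>1 *\<^sub>R dderiv u\<^sub>1 X x \<and> dderiv u\<^sub>2 N x = - \<kappa>\<^sub>2 *\<^sub>R dderiv u\<^sub>2 X x"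

lemma principal_frame_inner:
  assumes "principal_frame x u\<^sub>1 u\<^sub>2 \<kappa>\<^sub>1 \<kappa>\<^sub>2"
  shows "dderiv u\<^sub>1 X x \<bullet> dderiv u\<^sub>1 X x = 1" "dderiv u\<^sub>2 X x \<bullet> dderiv u\<^sub>2 X x = 1"
    "dderiv u\<^sub>1 X x \<bullet> dderiv u\<^sub>2 X x = 0" "dderiv u\<^sub>2 X x \<bullet> dderiv u\<^sub>1 X x = 0"
  using assms by (auto simp: principal_frame_def dot_square_norm inner_commute)

lemma ex_principal_frame:
  assumes "x \<in> T" obtains u\<^sub>1 u\<^sub>2 \<kappa>\<^sub>1 \<kappa>\<^sub>2 where "principal_frame x u\<^sub>1 u\<^sub>2 \<kappa>\<^sub>1 \<kappa>\<^sub>2"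
  by (rule principal_frame_exists[OF linear_dX[OF assms] immersed[OF assms] linear_dN[OF assms] unit_normal[OF assms]
        normal[OF assms] dN_tangential[OF assms] shape_operator_symmetric[OF assms]])
     (use that in \<open>auto simp: principal_frame_def\<close>)

lemma principal_frame_independent:
  assumes "x \<in> T" "principal_frame x u\<^sub>1 u\<^sub>2 \<kappa>\<^sub>1 \<kappa>\<^sub>2"
  shows "u\<^sub>1 \<noteq> u\<^sub>2 \<and> independent {u\<^sub>1, u\<^sub>2}"
proof (rule independent_pairI)
  fix a b assume "a *\<^sub>R u\<^sub>1 + b *\<^sub>R u\<^sub>2 = 0"
  then have "dderiv (a *\<^sub>R u\<^sub>1 + b *\<^sub>R u\<^sub>2) X x = 0" using linear_0[OF linear_dX[OF assms(1)]] by simp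
  then have eq: "a *\<^sub>R dderiv u\<^sub>1 X x + b *\<^sub>R dderiv u\<^sub>2 X x = 0"
    by (simp add: linear_add[OF linear_dX[OF assms(1)]] linear_scale[OF linear_dX[OF assms(1)]])
  have "(a *\<^sub>R dderiv u\<^sub>1 X x + b *\<^sub>R dderiv u\<^sub>2 X x) \<bullet> dderiv u\<^sub>1 X x = a"
    "(a *\<^sub>R dderiv u\<^sub>1 X x + b *\<^sub>R dderiv u\<^sub>2 X x) \<bullet> dderiv u\<^sub>2 X x = b"
    by (simp_all add: inner_add_left principal_frame_inner[OF assms(2)])
  then show "a = 0 \<and> b = 0" using eq by (metis inner_zero_left)
qed

lemma frame_expansion:
  assumes "x \<in> T" "principal_frame x u\<^sub>1 u\<^sub>2 \<kappa>\<^sub>1 \<kappa>\<^sub>2"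
  shows "y = (y \<bullet> dderiv u\<^sub>1 X x) *\<^sub>R dderiv u\<^sub>1 X x + (y \<bullet> dderiv u\<^sub>2 X x) *\<^sub>R dderiv u\<^sub>2 X x + (y \<bullet> N x) *\<^sub>R N x"
  by (rule orthonormal_expansion_3) (use assms normal unit_normal in \<open>auto simp: principal_frame_def\<close>)

lemma frame_inner_expansion:
  assumes "x \<in> T" "principal_frame x u\<^sub>1 u\<^sub>2 \<kappa>\<^sub>1 \<kappa>\<^sub>2"
  shows "y \<bullet> z = (y \<bullet> dderiv u\<^sub>1 X x) * (dderiv u\<^sub>1 X x \<bullet> z) + (y \<bullet> dderiv u\<^sub>2 X x) * (dderiv u\<^sub>2 X x \<bullet> z) + (y \<bullet> N x) * (N x \<bullet> z)"
  by (subst frame_expansion[OF assms, of y]) (simp add: inner_add_left)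

text \<open>By \<open>second_fundamental_form\<close> the normal component of \<open>V\<close> is \<open>\<kappa>\<^sub>1 + \<kappa>\<^sub>2\<close>, and its tangential part enters only
  through first derivatives of the height.\<close>

lemma height_hessian_trace:
  assumes "x \<in> T" "principal_frame x u\<^sub>1 u\<^sub>2 \<kappa>\<^sub>1 \<kappa>\<^sub>2"
  defines "V \<equiv> dderiv u\<^sub>1 (dderiv u\<^sub>1 X) x + dderiv u\<^sub>2 (dderiv u\<^sub>2 X) x"
  shows "V \<bullet> v = (\<kappa>\<^sub>1 + \<kappa>\<^sub>2) * (N x \<bullet> v)
    + (V \<bullet> dderiv u\<^sub>1 X x) * (dderiv u\<^sub>1 X x \<bullet> v) + (V \<bullet> dderiv u\<^sub>2 X x) * (dderiv u\<^sub>2 X x \<bullet> v)"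
proof -
  have "V \<bullet> N x = \<kappa>\<^sub>1 + \<kappa>\<^sub>2"
    using assms(2) by (simp add: V_def inner_add_left second_fundamental_form[OF assms(1)] principal_frame_def dot_square_norm)
  then show ?thesis using frame_inner_expansion[OF assms(1,2), of V v] by simp
qed

lemma dX_expansion:
  assumes "x \<in> T"
  shows "dderiv u X x = (\<Sum>b\<in>Basis. (u \<bullet> b) *\<^sub>R dderiv b X x)"
proof -
  have "dderiv (\<Sum>b\<in>Basis. (u \<bullet> b) *\<^sub>R b) X x = (\<Sum>b\<in>Basis. (u \<bullet> b) *\<^sub>R dderiv b X x)"
    by (simp only: linear_sum[OF linear_dX[OF assms]] linear_scale[OF linear_dX[OF assms]])
  then show ?thesis by (simp add: euclidean_representation)
qed

lemma ddX_expansion: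
  assumes "x \<in> T"
  shows "dderiv u (dderiv u X) x = (\<Sum>b\<in>Basis. \<Sum>c\<in>Basis. ((u \<bullet> b) * (u \<bullet> c)) *\<^sub>R dderiv c (dderiv b X) x)"
proof -
  have lin: "linear (\<lambda>a. dderiv a (dderiv v X) x)" for v
    using X_derivs(2)[OF assms] has_derivative_linear by blast
  have ex: "dderiv u (dderiv v X) x = (\<Sum>b\<in>Basis. (u \<bullet> b) *\<^sub>R dderiv b (dderiv v X) x)" for v
  proof -
    have "dderiv (\<Sum>b\<in>Basis. (u \<bullet> b) *\<^sub>R b) (dderiv v X) x = (\<Sum>b\<in>Basis. (u \<bullet> b) *\<^sub>R dderiv b (dderiv v X) x)"
      by (simp only: linear_sum[OF lin] linear_scale[OF lin])
    then show ?thesis by (simp add: euclidean_representation)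
  qed
  have "dderiv u (dderiv u X) x = (\<Sum>b\<in>Basis. (u \<bullet> b) *\<^sub>R dderiv u (dderiv b X) x)"
    by (subst ex) (intro sum.cong refl, simp add: symmetric_second_derivative[OF C2_X open_domain assms, of u])
  also have "\<dots> = (\<Sum>b\<in>Basis. \<Sum>c\<in>Basis. ((u \<bullet> b) * (u \<bullet> c)) *\<^sub>R dderiv c (dderiv b X) x)"
    by (subst ex) (simp add: scaleR_sum_right)
  finally show ?thesis .
qed

text \<open>All three quantities are homogeneous in \<open>u\<close> and continuous, so they are controlled on the compact set of
  pairs of a point of \<open>C\<close> and a unit vector. The lower bound is positive since \<open>X\<close> is an immersion.\<close>

lemma local_bounds:
  assumes C: "compact C" "C \<subseteq> T"
  obtains c d M where "c > 0" "d > 0" "M \<ge> 0"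
    "\<And>x u. x \<in> C \<Longrightarrow> c * norm u \<le> norm (dderiv u X x)"
    "\<And>x u. x \<in> C \<Longrightarrow> norm (dderiv u X x) \<le> d * norm u"
    "\<And>x u. x \<in> C \<Longrightarrow> norm (dderiv u (dderiv u X) x) \<le> M * (norm u)\<^sup>2"
proof (cases "C = {}")
  case True
  then show ?thesis using that[of 1 1 1] by auto
next
  case False
  let ?S = "C \<times> sphere (0::real^2) 1"
  have "sphere (0::real^2) 1 \<noteq> {}" by simp
  then have S: "compact ?S" "?S \<noteq> {}" using C False by (auto intro: compact_Times)
  have fst: "continuous_on ?S (\<lambda>z. g (fst z))" if "continuous_on T g" for g :: "real^2 \<Rightarrow> real^3"
    by (rule continuous_on_compose2[OF that]) (use C in \<open>auto intro!: continuous_intros\<close>)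
  have "continuous_on ?S (\<lambda>z. norm (\<Sum>b\<in>Basis. (snd z \<bullet> b) *\<^sub>R dderiv b X (fst z)))"
    by (intro continuous_intros fst X_derivs)
  then have c1: "continuous_on ?S (\<lambda>z. norm (dderiv (snd z) X (fst z)))"
    by (rule continuous_on_eq) (use C in \<open>auto simp: dX_expansion[symmetric]\<close>)
  have "continuous_on ?S (\<lambda>z. norm (\<Sum>b\<in>Basis. \<Sum>c\<in>Basis. ((snd z \<bullet> b) * (snd z \<bullet> c)) *\<^sub>R dderiv c (dderiv b X) (fst z)))"
    by (intro continuous_intros fst X_derivs)
  then have c2: "continuous_on ?S (\<lambda>z. norm (dderiv (snd z) (dderiv (snd z) X) (fst z)))"
    by (rule continuous_on_eq) (use C in \<open>auto simp: ddX_expansion[symmetric]\<close>)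
  obtain z1 where z1: "z1 \<in> ?S" "\<And>z. z \<in> ?S \<Longrightarrow> norm (dderiv (snd z1) X (fst z1)) \<le> norm (dderiv (snd z) X (fst z))"
    using continuous_attains_inf[OF S c1] by blast
  obtain z2 where z2: "z2 \<in> ?S" "\<And>z. z \<in> ?S \<Longrightarrow> norm (dderiv (snd z) X (fst z)) \<le> norm (dderiv (snd z2) X (fst z2))"
    using continuous_attains_sup[OF S c1] by blast
  obtain z3 where z3: "z3 \<in> ?S" "\<And>z. z \<in> ?S \<Longrightarrow> norm (dderiv (snd z) (dderiv (snd z) X) (fst z)) \<le> norm (dderiv (snd z3) (dderiv (snd z3) X) (fst z3))"
    using continuous_attains_sup[OF S c2] by blast
  define c d M where "c = norm (dderiv (snd z1) X (fst z1))" and "d = norm (dderiv (snd z2) X (fst z2))"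
    and "M = norm (dderiv (snd z3) (dderiv (snd z3) X) (fst z3))"
  have "fst z1 \<in> T" "snd z1 \<noteq> 0" using z1(1) C by auto
  then have c: "c > 0"
    unfolding c_def using immersed linear_dX linear_injective_0 by (metis zero_less_norm_iff)
  have d: "d > 0" using c z2(2)[OF z1(1)] unfolding c_def d_def by linarith
  have norm1: "(x, (1 / norm u) *\<^sub>R u) \<in> ?S" if "x \<in> C" "u \<noteq> 0" for x u
    using that by simp
  have scale: "dderiv (a *\<^sub>R u) X x = a *\<^sub>R dderiv u X x" 
     "dderiv (a *\<^sub>R u) (dderiv (a *\<^sub>R u) X) x = (a\<^sup>2) *\<^sub>R dderiv u (dderiv u X) x" if "x \<in> C" for a x u
  proof -
    have "x \<in> T" using that C by auto
    show "dderiv (a *\<^sub>R u) X x = a *\<^sub>R dderiv u X x" using linear_scale[OF linear_dX[OF \<open>x \<in> T\<close>]] .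
    show "dderiv (a *\<^sub>R u) (dderiv (a *\<^sub>R u) X) x = (a\<^sup>2) *\<^sub>R dderiv u (dderiv u X) x"
      by (simp add: ddX_expansion[OF \<open>x \<in> T\<close>] scaleR_sum_right power2_eq_square mult_ac)
  qed
  show ?thesis
  proof (rule that[OF c d, of M])
    show "M \<ge> 0" by (simp add: M_def)
    fix x and u :: "real^2" assume x: "x \<in> C"
    have xT: "x \<in> T" using x C by auto
    show "c * norm u \<le> norm (dderiv u X x)"
    proof (cases "u = 0")
      case False then show ?thesis using z1(2)[OF norm1[OF x False]] by (simp add: c_def[symmetric] scale[OF x] field_simps)
    qed (simp add: linear_0[OF linear_dX[OF xT]])
    show "norm (dderiv u X x) \<le> d * norm u"
    proof (cases "u = 0")
      case False then show ?thesis using z2(2)[OF norm1[OF x False]] by (simp add: d_def[symmetric] scale[OF x] field_simps)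
    qed (simp add: linear_0[OF linear_dX[OF xT]])
    show "norm (dderiv u (dderiv u X) x) \<le> M * (norm u)\<^sup>2"
    proof (cases "u = 0")
      case False then show ?thesis using z3(2)[OF norm1[OF x False]] by (simp add: M_def[symmetric] scale[OF x] field_simps)
    next
      case True then show ?thesis using ddX_expansion[OF xT, of 0] by simp
    qed
  qed
qed

text \<open>A frame that is orthonormal for the metric of \<open>X\<close> represents the inverse metric, which is bounded below
  where the metric is bounded above.\<close>

lemma frame_elliptic:
  assumes x: "x \<in> T" and fr: "principal_frame x u\<^sub>1 u\<^sub>2 \<kappa>\<^sub>1 \<kappa>\<^sub>2"
    and d: "d > 0" "\<And>u. norm (dderiv u X x) \<le> d * norm u"
  shows "(1 / d\<^sup>2) * (norm \<xi>)\<^sup>2 \<le> (u\<^sub>1 \<bullet> \<xi>)\<^sup>2 + (u\<^sub>2 \<bullet> \<xi>)\<^sup>2"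
proof -
  obtain a b where ab: "\<xi> = a *\<^sub>R u\<^sub>1 + b *\<^sub>R u\<^sub>2"
    using independent_pair_spans principal_frame_independent[OF x fr] by blast
  have "dderiv \<xi> X x = a *\<^sub>R dderiv u\<^sub>1 X x + b *\<^sub>R dderiv u\<^sub>2 X x"
    by (simp add: ab linear_add[OF linear_dX[OF x]] linear_scale[OF linear_dX[OF x]])
  then have "(norm (dderiv \<xi> X x))\<^sup>2 = a\<^sup>2 + b\<^sup>2"
    by (simp add: power2_norm_eq_inner inner_add_left inner_add_right principal_frame_inner[OF fr] power2_eq_square[of a] power2_eq_square[of b])
  moreover have "(norm (dderiv \<xi> X x))\<^sup>2 \<le> (d * norm \<xi>)\<^sup>2" by (intro power_mono d) auto
  ultimately have 1: "a\<^sup>2 + b\<^sup>2 \<le> d\<^sup>2 * (norm \<xi>)\<^sup>2" by (simp add: power_mult_distrib)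
  have "(norm \<xi>)\<^sup>2 = a * (u\<^sub>1 \<bullet> \<xi>) + b * (u\<^sub>2 \<bullet> \<xi>)"
    unfolding power2_norm_eq_inner by (subst (1) ab) (simp add: inner_add_left)
  moreover have "(a * p + b * q)\<^sup>2 \<le> (a\<^sup>2 + b\<^sup>2) * (p\<^sup>2 + q\<^sup>2)" for p q :: real
    using zero_le_power2[of "a * q - b * p"] by (simp add: power2_eq_square algebra_simps)
  ultimately have "((norm \<xi>)\<^sup>2)\<^sup>2 \<le> (a\<^sup>2 + b\<^sup>2) * ((u\<^sub>1 \<bullet> \<xi>)\<^sup>2 + (u\<^sub>2 \<bullet> \<xi>)\<^sup>2)" by metis
  also have "\<dots> \<le> (d\<^sup>2 * (norm \<xi>)\<^sup>2) * ((u\<^sub>1 \<bullet> \<xi>)\<^sup>2 + (u\<^sub>2 \<bullet> \<xi>)\<^sup>2)"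
    by (intro mult_right_mono 1) simp
  finally have "(norm \<xi>)\<^sup>2 * (norm \<xi>)\<^sup>2 \<le> (norm \<xi>)\<^sup>2 * (d\<^sup>2 * ((u\<^sub>1 \<bullet> \<xi>)\<^sup>2 + (u\<^sub>2 \<bullet> \<xi>)\<^sup>2))"
    by (simp add: power2_eq_square[of "(norm \<xi>)\<^sup>2"] mult_ac)
  then have "(norm \<xi>)\<^sup>2 \<le> d\<^sup>2 * ((u\<^sub>1 \<bullet> \<xi>)\<^sup>2 + (u\<^sub>2 \<bullet> \<xi>)\<^sup>2)"
    by (cases "\<xi> = 0") (simp, metis mult_le_cancel_left_pos zero_less_norm_iff zero_less_power)
  then show ?thesis using d(1) by (simp add: field_simps)
qed

end

section \<open>The height function of a parametrized translator\<close>

locale translator_patch = surface_patch +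
  fixes w :: "real^3" and l :: real
  assumes unit_w: "norm w = 1"
    and curvature_sum: "\<And>x u\<^sub>1 u\<^sub>2 \<kappa>\<^sub>1 \<kappa>\<^sub>2. x \<in> T \<Longrightarrow> principal_frame x u\<^sub>1 u\<^sub>2 \<kappa>\<^sub>1 \<kappa>\<^sub>2 \<Longrightarrow>
      \<kappa>\<^sub>1 + \<kappa>\<^sub>2 = 2 * (N x \<bullet> w + l)"
begin

text \<open>The equation \<open>\<Delta>f + 2 \<langle>w, \<nabla>f\<rangle> = 2 (\<langle>w, v\<rangle> + l \<langle>N, v\<rangle>)\<close> at a single point: the product \<open>\<langle>w, N\<rangle> \<langle>N, v\<rangle>\<close>
  coming from the mean curvature is \<open>\<langle>w, v\<rangle>\<close> minus the contribution of the tangential part of \<open>w\<close>.\<close>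

lemma height_equation:
  assumes "x \<in> T" "principal_frame x u\<^sub>1 u\<^sub>2 \<kappa>\<^sub>1 \<kappa>\<^sub>2"
  defines "V \<equiv> dderiv u\<^sub>1 (dderiv u\<^sub>1 X) x + dderiv u\<^sub>2 (dderiv u\<^sub>2 X) x"
  shows "V \<bullet> v = 2 * (w \<bullet> v + l * (N x \<bullet> v))
    + ((V - 2 *\<^sub>R w) \<bullet> dderiv u\<^sub>1 X x) * (dderiv u\<^sub>1 X x \<bullet> v) + ((V - 2 *\<^sub>R w) \<bullet> dderiv u\<^sub>2 X x) * (dderiv u\<^sub>2 X x \<bullet> v)"
  using height_hessian_trace[OF assms(1,2), of v, folded V_def]
    curvature_sum[OF assms(1,2)] frame_inner_expansion[OF assms(1,2), of w v]
  by (simp add: inner_diff_left algebra_simps inner_commute)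

text \<open>The term \<open>2 (\<langle>w, v\<rangle> + l \<langle>N, v\<rangle>)\<close> is nonnegative because \<open>|\<langle>N, v\<rangle>| \<le> 1\<close> and \<open>0 \<le> l \<le> \<langle>w, v\<rangle>\<close>; what remains is of
  first order.\<close>

lemma height_inequality:
  assumes x: "x \<in> T" and fr: "principal_frame x u\<^sub>1 u\<^sub>2 \<kappa>\<^sub>1 \<kappa>\<^sub>2"
    and v: "norm v = 1" "0 \<le> l" "l \<le> w \<bullet> v"
  defines "V \<equiv> dderiv u\<^sub>1 (dderiv u\<^sub>1 X) x + dderiv u\<^sub>2 (dderiv u\<^sub>2 X) x"
  shows "- ((norm V + 2) * (\<bar>dderiv u\<^sub>1 X x \<bullet> v\<bar> + \<bar>dderiv u\<^sub>2 X x \<bullet> v\<bar>)) \<le> V \<bullet> v"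
proof -
  have "\<bar>N x \<bullet> v\<bar> \<le> 1" using Cauchy_Schwarz_ineq2[of "N x" v] unit_normal[OF x] v by simp
  then have "l * (- 1) \<le> l * (N x \<bullet> v)" using v by (intro mult_left_mono) auto
  then have 0: "0 \<le> 2 * (w \<bullet> v + l * (N x \<bullet> v))" using v by simp
  have "\<bar>(V - 2 *\<^sub>R w) \<bullet> e\<bar> \<le> norm V + 2" if "norm e = 1" for e
  proof -
    have "\<bar>(V - 2 *\<^sub>R w) \<bullet> e\<bar> \<le> norm (V - 2 *\<^sub>R w)"
      using Cauchy_Schwarz_ineq2[of "V - 2 *\<^sub>R w" e] that by simp
    also have "\<dots> \<le> norm V + 2" using norm_triangle_ineq4[of V "2 *\<^sub>R w"] unit_w by simp
    finally show ?thesis .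
  qed
  then have "\<bar>((V - 2 *\<^sub>R w) \<bullet> e) * t\<bar> \<le> (norm V + 2) * \<bar>t\<bar>" if "norm e = 1" for e t
    unfolding abs_mult using that by (intro mult_right_mono) auto
  then have b: "- ((norm V + 2) * \<bar>t\<bar>) \<le> ((V - 2 *\<^sub>R w) \<bullet> e) * t" if "norm e = 1" for e t
    using that by (metis abs_le_D2 minus_le_iff)
  show ?thesis
    using height_equation[OF x fr, of v, folded V_def] 0
      b[of "dderiv u\<^sub>1 X x" "dderiv u\<^sub>1 X x \<bullet> v"] b[of "dderiv u\<^sub>2 X x" "dderiv u\<^sub>2 X x \<bullet> v"] fr
    by (simp add: principal_frame_def algebra_simps)
qed

lemma height_strong_maximum_principle:
  assumes p: "p \<in> T" and v: "norm v = 1" "0 \<le> l" "l \<le> w \<bullet> v"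
    and max: "\<And>x. x \<in> T \<Longrightarrow> X x \<bullet> v \<le> X p \<bullet> v"
  shows "\<exists>e>0. ball p e \<subseteq> T \<and> (\<forall>x\<in>ball p e. X x \<bullet> v = X p \<bullet> v)"
proof -
  obtain r where r: "r > 0" "cball p r \<subseteq> T" using open_domain p open_contains_cball by blast
  obtain c d M where b: "c > 0" "d > 0" "M \<ge> 0"
    "\<And>x u. x \<in> cball p r \<Longrightarrow> c * norm u \<le> norm (dderiv u X x)"
    "\<And>x u. x \<in> cball p r \<Longrightarrow> norm (dderiv u X x) \<le> d * norm u"
    "\<And>x u. x \<in> cball p r \<Longrightarrow> norm (dderiv u (dderiv u X) x) \<le> M * (norm u)\<^sup>2"
    using local_bounds[OF compact_cball r(2)] by metis
  have bT: "ball p r \<subseteq> T" using r ball_subset_cball by blast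
  define K where "K = 2 * (M * (1 / c)\<^sup>2) + 2"
  have "\<exists>e>0. ball p e \<subseteq> ball p r \<and> (\<forall>x\<in>ball p e. X x \<bullet> v = X p \<bullet> v)"
  proof (rule strong_maximum_principle[where f="\<lambda>x. X x \<bullet> v" and ?f1.0="\<lambda>x u. dderiv u X x \<bullet> v"
      and ?f2.0="\<lambda>x u a. dderiv a (dderiv u X) x \<bullet> v" and \<theta>="1 / d\<^sup>2" and K=K and B="1 / c"])
    show "1 / d\<^sup>2 > 0" "K \<ge> 0" "1 / c \<ge> 0" using b by (auto simp: K_def)
    show "open (ball p r)" "p \<in> ball p r" using r by auto
    fix x assume x': "x \<in> ball p r"
    then have x: "x \<in> T" "x \<in> cball p r" using bT by auto
    show "((\<lambda>x. X x \<bullet> v) has_derivative (\<lambda>u. dderiv u X x \<bullet> v)) (at x)"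
      by (intro has_derivative_inner_left X_derivs x)
    show "((\<lambda>x. dderiv u X x \<bullet> v) has_derivative (\<lambda>a. dderiv a (dderiv u X) x \<bullet> v)) (at x)" for u
      by (intro has_derivative_inner_left X_derivs x)
    show "X x \<bullet> v \<le> X p \<bullet> v" using max x by blast
    obtain u\<^sub>1 u\<^sub>2 \<kappa>\<^sub>1 \<kappa>\<^sub>2 where fr: "principal_frame x u\<^sub>1 u\<^sub>2 \<kappa>\<^sub>1 \<kappa>\<^sub>2" using ex_principal_frame[OF x(1)] .
    have u: "norm u\<^sub>1 \<le> 1 / c" "norm u\<^sub>2 \<le> 1 / c"
      using b(4)[OF x(2), of u\<^sub>1] b(4)[OF x(2), of u\<^sub>2] fr b(1) by (simp_all add: principal_frame_def field_simps)
    define V where "V = dderiv u\<^sub>1 (dderiv u\<^sub>1 X) x + dderiv u\<^sub>2 (dderiv u\<^sub>2 X) x"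
    have "norm (dderiv u (dderiv u X) x) \<le> M * (1 / c)\<^sup>2" if "norm u \<le> 1 / c" for u
    proof -
      have "M * (norm u)\<^sup>2 \<le> M * (1 / c)\<^sup>2" using that b by (intro mult_left_mono power_mono) auto
      then show ?thesis using b(6)[OF x(2), of u] by linarith
    qed
    from this[OF u(1)] this[OF u(2)] have "norm V \<le> 2 * (M * (1 / c)\<^sup>2)"
      unfolding V_def using norm_triangle_ineq[of "dderiv u\<^sub>1 (dderiv u\<^sub>1 X) x" "dderiv u\<^sub>2 (dderiv u\<^sub>2 X) x"] by linarith
    then have "(norm V + 2) * (\<bar>dderiv u\<^sub>1 X x \<bullet> v\<bar> + \<bar>dderiv u\<^sub>2 X x \<bullet> v\<bar>) \<le> K * (\<bar>dderiv u\<^sub>1 X x \<bullet> v\<bar> + \<bar>dderiv u\<^sub>2 X x \<bullet> v\<bar>)"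
      by (intro mult_right_mono) (auto simp: K_def)
    moreover have "- ((norm V + 2) * (\<bar>dderiv u\<^sub>1 X x \<bullet> v\<bar> + \<bar>dderiv u\<^sub>2 X x \<bullet> v\<bar>)) \<le> V \<bullet> v"
      using height_inequality[OF x(1) fr v, folded V_def] .
    ultimately have "- K * (\<bar>dderiv u\<^sub>1 X x \<bullet> v\<bar> + \<bar>dderiv u\<^sub>2 X x \<bullet> v\<bar>)
        \<le> dderiv u\<^sub>1 (dderiv u\<^sub>1 X) x \<bullet> v + dderiv u\<^sub>2 (dderiv u\<^sub>2 X) x \<bullet> v"
      by (simp add: V_def inner_add_left)
    moreover have "\<forall>\<xi>. 1 / d\<^sup>2 * (norm \<xi>)\<^sup>2 \<le> (u\<^sub>1 \<bullet> \<xi>)\<^sup>2 + (u\<^sub>2 \<bullet> \<xi>)\<^sup>2"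
      using frame_elliptic[OF x(1) fr b(2) b(5)[OF x(2)]] by blast
    ultimately show "\<exists>u\<^sub>1 u\<^sub>2. norm u\<^sub>1 \<le> 1 / c \<and> norm u\<^sub>2 \<le> 1 / c \<and>
        (\<forall>\<xi>. 1 / d\<^sup>2 * (norm \<xi>)\<^sup>2 \<le> (u\<^sub>1 \<bullet> \<xi>)\<^sup>2 + (u\<^sub>2 \<bullet> \<xi>)\<^sup>2) \<and>
        - K * (\<bar>dderiv u\<^sub>1 X x \<bullet> v\<bar> + \<bar>dderiv u\<^sub>2 X x \<bullet> v\<bar>)
          \<le> dderiv u\<^sub>1 (dderiv u\<^sub>1 X) x \<bullet> v + dderiv u\<^sub>2 (dderiv u\<^sub>2 X) x \<bullet> v"
      using u by blast
  qed
  then show ?thesis using bT by blast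
qed

end

section \<open>Charts, the boundary and planar surfaces\<close>

lemma smooth_on_differentiable_within:
  assumes "smooth_on S f" "x \<in> S"
  shows "f differentiable (at x within S)"
proof -
  obtain W g where W: "open W" "x \<in> W" "Ck_on_open (Suc 0) g W" "\<forall>y\<in>S \<inter> W. f y = g y"
    using assms unfolding smooth_on_def by meson
  then have "g differentiable (at x)" by (simp add: differentiable_on_eq_differentiable_at)
  then obtain D where "(g has_derivative D) (at x within S)"
    by (meson differentiable_at_withinI differentiable_def)
  moreover have "eventually (\<lambda>y. g y = f y) (at x within S)"
    using W by (auto simp: eventually_at_topological)
  ultimately have "(f has_derivative D) (at x within S)"
    using has_derivative_transform_eventually[of g D x S f] W assms by simp
  then show ?thesis by (auto simp: differentiable_def)
qed

lemma open_upper_half: "open {y :: real^2. y $ 2 > 0}"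
  by (intro open_Collect_less continuous_intros)

lemma open_in_half_plane:
  assumes "openin (top_of_set half_plane) S"
  shows "open (S \<inter> {y. y $ 2 > 0})"
proof -
  obtain T where T: "open T" "S = half_plane \<inter> T" using assms by (auto simp: openin_open)
  then have "S \<inter> {y. y $ 2 > 0} = T \<inter> {y. y $ 2 > 0}" by (auto simp: half_plane_def)
  then show ?thesis using T open_upper_half by auto
qed

lemma half_plane_push_up:
  fixes y :: "real^2"
  assumes "y \<in> half_plane" "e > 0"
  shows "y + (e / 2) *\<^sub>R axis 2 1 \<in> ball y e" "(y + (e / 2) *\<^sub>R axis 2 1) $ 2 > 0"
  using assms by (auto simp: dist_norm half_plane_def axis_def add_nonneg_pos norm_axis_1[of 2, unfolded axis_def])

lemma smooth_map_chart: "smooth_map A f \<Longrightarrow> (U, \<phi>) \<in> A \<Longrightarrow> smooth_on (\<phi> ` U) (f \<circ> inv_into U \<phi>)"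
  by (auto simp: smooth_map_def)

locale oriented_surface =
  fixes M :: "'a topology" and A :: "'a chart set" and \<psi> N :: "'a \<Rightarrow> real^3"
  assumes oriented: "oriented_immersed_surface M A \<psi> N"
begin

lemma chart_props:
  assumes "(U, \<phi>) \<in> A"
  shows "openin M U" "openin (top_of_set half_plane) (\<phi> ` U)" "inj_on \<phi> U" "U \<subseteq> topspace M"
    and "homeomorphic_map (subtopology M U) (top_of_set (\<phi> ` U)) \<phi>"
proof -
  have "is_chart M (U, \<phi>)"
    using oriented assms by (auto simp: oriented_immersed_surface_def smooth_surface_def smooth_atlas_def)
  then show 1: "openin M U" "openin (top_of_set half_plane) (\<phi> ` U)"
    and 2: "homeomorphic_map (subtopology M U) (top_of_set (\<phi> ` U)) \<phi>"
    by (auto simp: is_chart_def)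
  show s: "U \<subseteq> topspace M" using 1 openin_subset by blast
  show "inj_on \<phi> U" using homeomorphic_imp_injective_map[OF 2] s by (simp add: inf.absorb2)
qed

lemma chart_exists:
  assumes "p \<in> topspace M" obtains U \<phi> where "(U, \<phi>) \<in> A" "p \<in> U"
proof -
  have "topspace M = (\<Union>(U, \<phi>)\<in>A. U)"
    using oriented by (simp add: oriented_immersed_surface_def smooth_surface_def smooth_atlas_def)
  then show ?thesis using assms that by auto
qed

lemma transition_smooth:
  assumes "(U, \<phi>) \<in> A" "(V, \<eta>) \<in> A"
  shows "smooth_on (\<phi> ` (U \<inter> V)) (\<eta> \<circ> inv_into U \<phi>)"
  using oriented assms by (fastforce simp: oriented_immersed_surface_def smooth_surface_def smooth_atlas_def)

lemma smooth_\<psi>: "smooth_map A \<psi>" and smooth_N: "smooth_map A N"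
  using oriented by (auto simp: oriented_immersed_surface_def immersion_def gauss_map_def)

lemma chart_open_image:
  assumes "(U, \<phi>) \<in> A" "openin M G" "G \<subseteq> U"
  shows "openin (top_of_set half_plane) (\<phi> ` G)"
proof -
  have "openin (subtopology M U) G" using assms by (simp add: openin_open_subtopology chart_props)
  then have "openin (top_of_set (\<phi> ` U)) (\<phi> ` G)"
    using homeomorphic_imp_open_map[OF chart_props(5)[OF assms(1)]] by (simp add: open_map_def)
  then show ?thesis using chart_props(2)[OF assms(1)] openin_trans by blast
qed

lemma chart_height_nonneg: "(U, \<phi>) \<in> A \<Longrightarrow> p \<in> U \<Longrightarrow> \<phi> p \<in> half_plane"
  using chart_props(2) openin_imp_subset by blast

definition chart_interior :: "'a chart \<Rightarrow> (real^2) set" where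
  "chart_interior c = snd c ` fst c \<inter> {y. y $ 2 > 0}"

lemma open_chart_interior: "(U, \<phi>) \<in> A \<Longrightarrow> open (chart_interior (U, \<phi>))"
  using open_in_half_plane[OF chart_props(2)] by (simp add: chart_interior_def)

lemma chart_diff_has_derivative:
  assumes "smooth_map A f" "(U, \<phi>) \<in> A" "p \<in> U"
  shows "((f \<circ> inv_into U \<phi>) has_derivative chart_diff (U, \<phi>) f p) (at (\<phi> p) within \<phi> ` U)"
proof -
  have "smooth_on (\<phi> ` U) (f \<circ> inv_into U \<phi>)" using assms by (intro smooth_map_chart)
  then show ?thesis
    using assms smooth_on_differentiable_within frechet_derivative_works unfolding chart_diff_def by fastforce
qed

lemma chart_diff_interior:
  assumes "smooth_map A f" "(U, \<phi>) \<in> A" "p \<in> U" "\<phi> p $ 2 > 0"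
  shows "((f \<circ> inv_into U \<phi>) has_derivative chart_diff (U, \<phi>) f p) (at (\<phi> p))"
    and "dderiv u (f \<circ> inv_into U \<phi>) (\<phi> p) = chart_diff (U, \<phi>) f p u"
proof -
  have "\<phi> p \<in> interior (\<phi> ` U)"
    by (rule interiorI[OF open_chart_interior[OF assms(2)]]) (use assms in \<open>auto simp: chart_interior_def\<close>)
  then show 1: "((f \<circ> inv_into U \<phi>) has_derivative chart_diff (U, \<phi>) f p) (at (\<phi> p))"
    using chart_diff_has_derivative[OF assms(1-3)] at_within_interior by metis
  show "dderiv u (f \<circ> inv_into U \<phi>) (\<phi> p) = chart_diff (U, \<phi>) f p u"
    using frechet_derivative_at[OF 1] by (simp add: dderiv_def)
qed

lemma chart_diff_inj: "(U, \<phi>) \<in> A \<Longrightarrow> p \<in> U \<Longrightarrow> inj (chart_diff (U, \<phi>) \<psi> p)"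
  using oriented by (fastforce simp: oriented_immersed_surface_def immersion_def)

text \<open>Since \<open>\<psi>\<close> is an immersion in either chart, the chain rule makes the differential \<open>\<tau>\<close> of the coordinate
  change injective, hence surjective. The point cannot lie on the edge of the half-plane in the second
  chart: there the second coordinate would have a minimum, and \<open>\<tau>\<close> would take values in the edge.\<close>

lemma transition:
  assumes c: "(U, \<phi>) \<in> A" "(V, \<eta>) \<in> A" and p: "p \<in> U" "p \<in> V" "\<phi> p $ 2 > 0"
  obtains \<tau> where "linear \<tau>" "inj \<tau>" "\<eta> p $ 2 > 0"
    "\<forall>f. smooth_map A f \<longrightarrow> chart_diff (U, \<phi>) f p = chart_diff (V, \<eta>) f p \<circ> \<tau>"
proof -
  define S where "S = \<phi> ` (U \<inter> V) \<inter> {y. y $ 2 > 0}"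
  define t where "t = \<eta> \<circ> inv_into U \<phi>"
  note inj = chart_props(3)[OF c(1)] chart_props(3)[OF c(2)]
  have "openin (top_of_set half_plane) (\<phi> ` (U \<inter> V))"
    by (rule chart_open_image[OF c(1)]) (use c chart_props(1) in auto)
  then have S: "open S" unfolding S_def by (rule open_in_half_plane)
  have x: "\<phi> p \<in> S" using p by (auto simp: S_def)
  have tS: "t y = \<eta> q \<and> q \<in> U \<inter> V" if y: "y \<in> S" and q: "q = inv_into U \<phi> y" for y q
  proof -
    obtain q' where q': "q' \<in> U \<inter> V" "y = \<phi> q'" using y unfolding S_def by blast
    then have "inv_into U \<phi> y = q'" using inj(1) by simp
    then show ?thesis using q' q by (simp add: t_def)
  qed
  have tx: "t (\<phi> p) = \<eta> p" using p inj by (simp add: t_def)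
  have "Ck_on_open (Suc 0) t S"
    unfolding t_def by (rule smooth_on_imp_Ck_on_interior[OF transition_smooth[OF c] S]) (auto simp: S_def)
  then have "t differentiable (at (\<phi> p))" using x S by (simp add: differentiable_on_eq_differentiable_at)
  then obtain \<tau> where \<tau>: "(t has_derivative \<tau>) (at (\<phi> p))" by (auto simp: differentiable_def)
  have chain: "chart_diff (U, \<phi>) f p = chart_diff (V, \<eta>) f p \<circ> \<tau>" if f: "smooth_map A f" for f
  proof -
    have sub: "t ` S \<subseteq> \<eta> ` V" using tS by blast
    have "((f \<circ> inv_into V \<eta>) has_derivative chart_diff (V, \<eta>) f p) (at (t (\<phi> p)) within t ` S)"
      unfolding tx by (rule has_derivative_subset[OF chart_diff_has_derivative[OF f c(2) p(2)] sub])
    then have "((f \<circ> inv_into V \<eta>) \<circ> t has_derivative chart_diff (V, \<eta>) f p \<circ> \<tau>) (at (\<phi> p) within S)"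
      by (intro diff_chain_within has_derivative_at_withinI[OF \<tau>])
    then have "((f \<circ> inv_into V \<eta>) \<circ> t has_derivative chart_diff (V, \<eta>) f p \<circ> \<tau>) (at (\<phi> p))"
      by (simp only: at_within_open[OF x S])
    then have "((f \<circ> inv_into U \<phi>) has_derivative chart_diff (V, \<eta>) f p \<circ> \<tau>) (at (\<phi> p))"
    proof (rule has_derivative_transform_within_open[OF _ S x])
      fix y assume "y \<in> S"
      then show "(f \<circ> inv_into V \<eta> \<circ> t) y = (f \<circ> inv_into U \<phi>) y"
        using tS[OF \<open>y \<in> S\<close> refl] inj by simp
    qed
    then show ?thesis using chart_diff_interior(1)[OF f c(1) p(1,3)] has_derivative_unique by blast
  qed
  have lin: "linear \<tau>" using \<tau> has_derivative_linear by blast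
  have injt: "inj \<tau>"
    using chart_diff_inj[OF c(1) p(1)] chain[OF smooth_\<psi>] by (metis inj_on_imageI2)
  have "\<eta> p $ 2 \<noteq> 0"
  proof
    assume z: "\<eta> p $ 2 = 0"
    have d: "((\<lambda>y. t y $ 2) has_derivative (\<lambda>u. \<tau> u $ 2)) (at (\<phi> p))"
      using \<tau> by (rule bounded_linear.has_derivative[OF bounded_linear_vec_nth])
    have "t (\<phi> p) $ 2 \<le> t y $ 2" if "y \<in> S" for y
      using tS[OF that refl] chart_height_nonneg[OF c(2)] z tx by (auto simp: half_plane_def)
    then have "(\<lambda>u. \<tau> u $ 2) = (\<lambda>_. 0)"
      using differential_zero_maxmin[OF x S d] by blast
    moreover obtain u where "\<tau> u = axis 2 1"
      using linear_injective_imp_surjective[OF lin injt] by (metis surjD)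
    ultimately show False by (metis axis_nth zero_neq_one)
  qed
  then have "\<eta> p $ 2 > 0" using chart_height_nonneg[OF c(2) p(2)] by (simp add: half_plane_def)
  then show ?thesis using that lin injt chain by blast
qed

text \<open>By \<open>transition\<close> it does not matter which chart is consulted.\<close>

lemma surface_interior_iff:
  assumes "(U, \<phi>) \<in> A" "p \<in> U"
  shows "p \<in> surface_interior M A \<longleftrightarrow> \<phi> p $ 2 > 0"
proof
  assume "p \<in> surface_interior M A"
  then have "\<phi> p $ 2 \<noteq> 0" using assms by (auto simp: surface_interior_def surface_boundary_def)
  then show "\<phi> p $ 2 > 0" using chart_height_nonneg[OF assms] by (simp add: half_plane_def)
next
  assume pos: "\<phi> p $ 2 > 0"
  have "p \<notin> surface_boundary A"
  proof
    assume "p \<in> surface_boundary A"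
    then obtain V \<eta> where V: "(V, \<eta>) \<in> A" "p \<in> V" "\<eta> p $ 2 = 0" by (auto simp: surface_boundary_def)
    then show False using transition[OF assms(1) V(1) assms(2) V(2) pos] by (metis less_irrefl)
  qed
  then show "p \<in> surface_interior M A" using chart_props(4)[OF assms(1)] assms by (auto simp: surface_interior_def)
qed

lemma open_set_meets_interior:
  assumes "(U, \<phi>) \<in> A" "openin M G" "G \<subseteq> U" "G \<noteq> {}"
  obtains q where "q \<in> G" "\<phi> q $ 2 > 0"
proof -
  obtain T where T: "open T" "\<phi> ` G = half_plane \<inter> T"
    using chart_open_image[OF assms(1-3)] by (auto simp: openin_open)
  obtain q where q: "q \<in> G" using assms by auto
  then have "\<phi> q \<in> T" "\<phi> q \<in> half_plane" using T by auto
  then obtain e where "e > 0" "ball (\<phi> q) e \<subseteq> T" using T open_contains_ball by blast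
  then have "\<phi> q + (e/2) *\<^sub>R axis 2 1 \<in> half_plane \<inter> T" "(\<phi> q + (e/2) *\<^sub>R axis 2 1) $ 2 > 0"
    using half_plane_push_up[OF \<open>\<phi> q \<in> half_plane\<close> \<open>e > 0\<close>] by (auto simp: half_plane_def)
  then show ?thesis using that T(2) by (metis imageE)
qed

lemma surface_interior_nonempty: "surface_interior M A \<noteq> {}"
proof -
  obtain p where "p \<in> topspace M" using oriented unfolding oriented_immersed_surface_def by blast
  then obtain U \<phi> where c: "(U, \<phi>) \<in> A" "p \<in> U" using chart_exists by blast
  then obtain q where "q \<in> U" "\<phi> q $ 2 > 0"
    using open_set_meets_interior[OF c(1) chart_props(1)[OF c(1)]] by blast
  then show ?thesis using surface_interior_iff[OF c(1)] by blast
qed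

lemma patch:
  assumes c: "(U, \<phi>) \<in> A"
  shows "surface_patch (chart_interior (U, \<phi>)) (\<psi> \<circ> inv_into U \<phi>) (N \<circ> inv_into U \<phi>)"
proof
  show o: "open (chart_interior (U, \<phi>))" by (rule open_chart_interior[OF c])
  have sub: "chart_interior (U, \<phi>) \<subseteq> \<phi> ` U" by (auto simp: chart_interior_def)
  show "Ck_on_open 2 (\<psi> \<circ> inv_into U \<phi>) (chart_interior (U, \<phi>))"
    by (rule smooth_on_imp_Ck_on_interior[OF _ o sub]) (rule smooth_map_chart[OF smooth_\<psi> c])
  show "Ck_on_open 2 (N \<circ> inv_into U \<phi>) (chart_interior (U, \<phi>))"
    by (rule smooth_on_imp_Ck_on_interior[OF _ o sub]) (rule smooth_map_chart[OF smooth_N c])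
  fix x assume "x \<in> chart_interior (U, \<phi>)"
  then obtain p where p: "p \<in> U" "x = \<phi> p" "\<phi> p $ 2 > 0" by (auto simp: chart_interior_def)
  have inv: "inv_into U \<phi> x = p" using p chart_props(3)[OF c] by simp
  note d = chart_diff_interior(2)[OF smooth_\<psi> c p(1,3)]
  have g: "norm (N p) = 1 \<and> (\<forall>u. chart_diff (U, \<phi>) \<psi> p u \<bullet> N p = 0)"
    using oriented c p by (fastforce simp: oriented_immersed_surface_def gauss_map_def)
  show "inj (\<lambda>u. dderiv u (\<psi> \<circ> inv_into U \<phi>) x)"
    using chart_diff_inj[OF c p(1)] p d by simp
  show "norm ((N \<circ> inv_into U \<phi>) x) = 1" using g inv by simp
  show "dderiv u (\<psi> \<circ> inv_into U \<phi>) x \<bullet> (N \<circ> inv_into U \<phi>) x = 0" for u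
    using g inv p d by simp
qed

text \<open>The mean curvature is defined by a description over all charts; it is legitimate because \<open>transition\<close>
  carries principal directions from one chart to another and \<open>eigenvalue_sum_unique\<close> settles the case of
  a single chart.\<close>

lemma mean_curvature_principal_frame:
  assumes c: "(U, \<phi>) \<in> A" and p: "p \<in> U" "\<phi> p $ 2 > 0"
    and fr: "surface_patch.principal_frame (\<psi> \<circ> inv_into U \<phi>) (N \<circ> inv_into U \<phi>) (\<phi> p) u\<^sub>1 u\<^sub>2 \<kappa>\<^sub>1 \<kappa>\<^sub>2"
  shows "mean_curvature A \<psi> N p = (\<kappa>\<^sub>1 + \<kappa>\<^sub>2) / 2"
proof -
  interpret surface_patch "chart_interior (U, \<phi>)" "\<psi> \<circ> inv_into U \<phi>" "N \<circ> inv_into U \<phi>" by (rule patch[OF c])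
  define L where "L = chart_diff (U, \<phi>) \<psi> p"
  define P where "P = chart_diff (U, \<phi>) N p"
  have x: "\<phi> p \<in> chart_interior (U, \<phi>)" using p by (auto simp: chart_interior_def)
  have L: "linear L" "inj L" and P: "linear P"
    using chart_diff_interior(1)[OF smooth_\<psi> c p] chart_diff_interior(1)[OF smooth_N c p] chart_diff_inj[OF c p(1)]
      has_derivative_linear by (auto simp: L_def P_def)
  have ind: "u\<^sub>1 \<noteq> u\<^sub>2" "independent {u\<^sub>1, u\<^sub>2}" using principal_frame_independent[OF x fr] by auto
  have ev: "P u\<^sub>1 = - \<kappa>\<^sub>1 *\<^sub>R L u\<^sub>1" "P u\<^sub>2 = - \<kappa>\<^sub>2 *\<^sub>R L u\<^sub>2"
    using fr by (simp_all add: principal_frame_def L_def P_def chart_diff_interior(2)[OF smooth_\<psi> c p] chart_diff_interior(2)[OF smooth_N c p])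
  have pc: "principal_curvatures A \<psi> N p \<kappa>\<^sub>1 \<kappa>\<^sub>2"
    unfolding principal_curvatures_def using c p ind ev[unfolded L_def P_def]
    by (intro bexI[of _ "(U, \<phi>)"] conjI exI[of _ u\<^sub>1] exI[of _ u\<^sub>2]) auto
  have uniq: "\<mu>\<^sub>1 + \<mu>\<^sub>2 = \<kappa>\<^sub>1 + \<kappa>\<^sub>2" if mu: "principal_curvatures A \<psi> N p \<mu>\<^sub>1 \<mu>\<^sub>2" for \<mu>\<^sub>1 \<mu>\<^sub>2
  proof -
    obtain V \<eta> a b where V: "(V, \<eta>) \<in> A" "p \<in> V" "a \<noteq> b" "independent {a, b}"
      "chart_diff (V, \<eta>) N p a = - \<mu>\<^sub>1 *\<^sub>R chart_diff (V, \<eta>) \<psi> p a"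
      "chart_diff (V, \<eta>) N p b = - \<mu>\<^sub>2 *\<^sub>R chart_diff (V, \<eta>) \<psi> p b"
      using mu unfolding principal_curvatures_def by fastforce
    have "p \<in> surface_interior M A" using surface_interior_iff[OF c p(1)] p(2) by simp
    then have pos: "\<eta> p $ 2 > 0" using surface_interior_iff[OF V(1,2)] by simp
    obtain \<tau> where \<tau>: "linear \<tau>" "inj \<tau>" "\<phi> p $ 2 > 0"
      "\<forall>f. smooth_map A f \<longrightarrow> chart_diff (V, \<eta>) f p = chart_diff (U, \<phi>) f p \<circ> \<tau>"
      using transition[OF V(1) c V(2) p(1) pos] .
    have "independent (\<tau> ` {a, b})"
      by (rule linear_independent_injective_image[OF \<tau>(1) V(4)]) (use \<tau>(2) in \<open>auto intro: inj_on_subset\<close>)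
    moreover have "\<tau> a \<noteq> \<tau> b" using V(3) \<tau>(2) by (simp add: inj_eq)
    moreover have "P (\<tau> a) = - \<mu>\<^sub>1 *\<^sub>R L (\<tau> a)" "P (\<tau> b) = - \<mu>\<^sub>2 *\<^sub>R L (\<tau> b)"
      using V(5,6) by (simp_all add: \<tau>(4)[rule_format, OF smooth_\<psi>] \<tau>(4)[rule_format, OF smooth_N] L_def P_def)
    ultimately show ?thesis
      using eigenvalue_sum_unique[OF L P ind ev, of "\<tau> a" "\<tau> b" \<mu>\<^sub>1 \<mu>\<^sub>2] by simp
  qed
  show ?thesis
    unfolding mean_curvature_def
  proof (rule the_equality)
    show "\<exists>k\<^sub>1 k\<^sub>2. principal_curvatures A \<psi> N p k\<^sub>1 k\<^sub>2 \<and> (\<kappa>\<^sub>1 + \<kappa>\<^sub>2) / 2 = (k\<^sub>1 + k\<^sub>2) / 2" using pc by blast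
  qed (use uniq in auto)
qed

lemma continuous_map_\<psi>: "continuous_map M euclidean \<psi>"
proof (rule pasting_lemma[where I=A and T=fst and f="\<lambda>_. \<psi>"])
  fix c assume "c \<in> A"
  then obtain U \<phi> where c: "c = (U, \<phi>)" "(U, \<phi>) \<in> A" by (cases c) auto
  then show "openin M (fst c)" using chart_props(1) by simp
  have "continuous_map (subtopology M U) (top_of_set (\<phi> ` U)) \<phi>"
    using chart_props(5)[OF c(2)] homeomorphic_imp_continuous_map by blast
  moreover have "continuous_on (\<phi> ` U) (\<psi> \<circ> inv_into U \<phi>)"
    by (intro smooth_on_imp_continuous_on smooth_map_chart[OF smooth_\<psi> c(2)])
  ultimately have "continuous_map (subtopology M U) euclidean ((\<psi> \<circ> inv_into U \<phi>) \<circ> \<phi>)"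
    by (auto intro: continuous_map_compose)
  then have "continuous_map (subtopology M U) euclidean \<psi>"
    by (rule continuous_map_eq) (use chart_props(3,4)[OF c(2)] in auto)
  then show "continuous_map (subtopology M (fst c)) euclidean \<psi>" by (simp add: c)
next
  fix p assume "p \<in> topspace M"
  then show "\<exists>j. j \<in> A \<and> p \<in> fst j \<and> \<psi> p = \<psi> p" using chart_exists by (metis fst_conv)
qed auto

lemma height_attains_max:
  assumes "compact_space M"
  obtains p where "p \<in> topspace M" "\<And>q. q \<in> topspace M \<Longrightarrow> \<psi> q \<bullet> v \<le> \<psi> p \<bullet> v"
proof -
  have "compactin euclidean (\<psi> ` topspace M)"
    using assms continuous_map_\<psi> image_compactin unfolding compact_space_def by blast
  then have "compact (\<psi> ` topspace M)" by simp
  moreover have "\<psi> ` topspace M \<noteq> {}" using oriented unfolding oriented_immersed_surface_def by blast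
  ultimately have "\<exists>y\<in>\<psi> ` topspace M. \<forall>z\<in>\<psi> ` topspace M. z \<bullet> v \<le> y \<bullet> v"
    by (rule continuous_attains_sup) (intro continuous_intros)
  then show ?thesis using that by auto
qed

lemma interior_maximum_tangent:
  assumes p: "p \<in> surface_interior M A"
    and max: "\<And>q. q \<in> topspace M \<Longrightarrow> \<psi> q \<bullet> v \<le> \<psi> p \<bullet> v"
  shows "v = (v \<bullet> N p) *\<^sub>R N p"
proof -
  have "p \<in> topspace M" using p by (simp add: surface_interior_def)
  then obtain U \<phi> where c: "(U, \<phi>) \<in> A" "p \<in> U" using chart_exists by blast
  interpret surface_patch "chart_interior (U, \<phi>)" "\<psi> \<circ> inv_into U \<phi>" "N \<circ> inv_into U \<phi>" by (rule patch[OF c(1)])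
  have "\<phi> p $ 2 > 0" using surface_interior_iff[OF c] p by simp
  then have x: "\<phi> p \<in> chart_interior (U, \<phi>)" using c by (auto simp: chart_interior_def)
  have inv: "inv_into U \<phi> (\<phi> q) = q" if "q \<in> U" for q using that chart_props(3)[OF c(1)] by simp
  have "(\<lambda>u. dderiv u (\<psi> \<circ> inv_into U \<phi>) (\<phi> p) \<bullet> v) = (\<lambda>_. 0)"
  proof (rule differential_zero_maxmin[OF x open_domain])
    show "((\<lambda>x. (\<psi> \<circ> inv_into U \<phi>) x \<bullet> v) has_derivative (\<lambda>u. dderiv u (\<psi> \<circ> inv_into U \<phi>) (\<phi> p) \<bullet> v)) (at (\<phi> p))"
      by (intro has_derivative_inner_left X_derivs x)
    show "(\<forall>y\<in>chart_interior (U, \<phi>). (\<psi> \<circ> inv_into U \<phi>) y \<bullet> v \<le> (\<psi> \<circ> inv_into U \<phi>) (\<phi> p) \<bullet> v) \<or>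
      (\<forall>y\<in>chart_interior (U, \<phi>). (\<psi> \<circ> inv_into U \<phi>) (\<phi> p) \<bullet> v \<le> (\<psi> \<circ> inv_into U \<phi>) y \<bullet> v)"
      using max chart_props(4)[OF c(1)] inv c(2) by (auto simp: chart_interior_def)
  qed
  then have z: "v \<bullet> dderiv u (\<psi> \<circ> inv_into U \<phi>) (\<phi> p) = 0" for u by (metis inner_commute)
  obtain u\<^sub>1 u\<^sub>2 \<kappa>\<^sub>1 \<kappa>\<^sub>2 where "principal_frame (\<phi> p) u\<^sub>1 u\<^sub>2 \<kappa>\<^sub>1 \<kappa>\<^sub>2" using ex_principal_frame[OF x] .
  from frame_expansion[OF x this, of v] show ?thesis using z inv[OF c(2)] by simp
qed

text \<open>By \<open>interior_maximum_tangent\<close> the height in direction \<open>u\<close> has an interior maximum only if \<open>u\<close> is a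
  multiple of \<open>n\<close>. If \<open>v\<close> is not one, both extrema of the height in direction \<open>v\<close> lie on the boundary and
  are \<open>0\<close>. Otherwise that height is constant, and maximizing in a direction \<open>u\<close> that is not a multiple of
  \<open>n\<close> exhibits a boundary point, where it is \<open>0\<close>.\<close>

lemma planar_boundary_in_plane:
  assumes cpt: "compact_space M" and n: "n \<noteq> 0" "\<psi> ` topspace M \<subseteq> {x. x \<bullet> n = b}"
    and v: "v \<noteq> 0" and bd: "\<psi> ` surface_boundary A \<subseteq> {x. x \<bullet> v = 0}"
    and q: "q \<in> topspace M"
  shows "\<psi> q \<bullet> v = 0"
proof -
  have bd': "\<psi> p \<bullet> v = 0" if "p \<in> topspace M" "p \<notin> surface_interior M A" for p
    using that bd by (auto simp: surface_interior_def)
  have height: "\<psi> p \<bullet> n = b" if "p \<in> topspace M" for p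
    using subsetD[OF n(2) imageI[OF that]] by simp
  have par: "\<exists>k. u = k *\<^sub>R n" if p: "p \<in> surface_interior M A" and mx: "\<And>q. q \<in> topspace M \<Longrightarrow> \<psi> q \<bullet> u \<le> \<psi> p \<bullet> u" for p u
  proof -
    have nn: "n = (n \<bullet> N p) *\<^sub>R N p"
      by (rule interior_maximum_tangent[OF p]) (use height p in \<open>simp add: surface_interior_def\<close>)
    define k where "k = n \<bullet> N p"
    have nk: "n = k *\<^sub>R N p" unfolding k_def by (rule nn)
    then have "k \<noteq> 0" using n(1) by auto
    then have "N p = (1 / k) *\<^sub>R n" by (simp add: nk)
    then have "u = (u \<bullet> N p) *\<^sub>R (1 / k) *\<^sub>R n" using interior_maximum_tangent[OF p mx] by metis
    then show ?thesis by (metis scaleR_scaleR)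
  qed
  show ?thesis
  proof (cases "\<exists>k. v = k *\<^sub>R n")
    case False
    obtain p where p: "p \<in> topspace M" "\<And>q. q \<in> topspace M \<Longrightarrow> \<psi> q \<bullet> v \<le> \<psi> p \<bullet> v"
      using height_attains_max[OF cpt] by blast
    obtain p' where p': "p' \<in> topspace M" "\<And>q. q \<in> topspace M \<Longrightarrow> \<psi> q \<bullet> (- v) \<le> \<psi> p' \<bullet> (- v)"
      using height_attains_max[OF cpt] by blast
    have "\<nexists>k. - v = k *\<^sub>R n" using False by (metis minus_equation_iff scaleR_minus_left)
    then have "p \<notin> surface_interior M A" "p' \<notin> surface_interior M A" using par p p' False by blast+
    then have "\<psi> p \<bullet> v = 0" "\<psi> p' \<bullet> v = 0" using bd' p p' by auto
    then show ?thesis using p(2)[OF q] p'(2)[OF q] by simp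
  next
    case True
    then obtain k where k: "v = k *\<^sub>R n" by blast
    obtain u where u: "\<nexists>k. u = k *\<^sub>R n"
    proof (rule ccontr)
      assume "\<not> thesis"
      then have "UNIV \<subseteq> span {n}" using that by (auto simp: span_singleton)
      then have "dim (UNIV :: (real^3) set) \<le> card {n}" by (intro dim_le_card) auto
      then show False by simp
    qed
    obtain p where p: "p \<in> topspace M" "\<And>q. q \<in> topspace M \<Longrightarrow> \<psi> q \<bullet> u \<le> \<psi> p \<bullet> u"
      using height_attains_max[OF cpt] by blast
    then have "\<psi> p \<bullet> v = 0" using par u bd' by blast
    moreover have "\<psi> p \<bullet> n = b" "\<psi> q \<bullet> n = b" using height p q by auto
    ultimately show ?thesis by (simp add: k)
  qed
qed

end

section \<open>Heights on translating surfaces\<close>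

locale translating_surface = oriented_surface +
  fixes w :: "real^3" and l :: real
  assumes unit_w: "norm w = 1"
    and translator_eq: "\<And>p. p \<in> topspace M \<Longrightarrow> mean_curvature A \<psi> N p = N p \<bullet> w + l"
begin

lemma translating_patch:
  assumes c: "(U, \<phi>) \<in> A"
  shows "translator_patch (chart_interior (U, \<phi>)) (\<psi> \<circ> inv_into U \<phi>) (N \<circ> inv_into U \<phi>) w l"
proof -
  interpret surface_patch "chart_interior (U, \<phi>)" "\<psi> \<circ> inv_into U \<phi>" "N \<circ> inv_into U \<phi>" by (rule patch[OF c])
  show ?thesis
  proof
    fix x u\<^sub>1 u\<^sub>2 \<kappa>\<^sub>1 \<kappa>\<^sub>2
    assume x: "x \<in> chart_interior (U, \<phi>)" and fr: "principal_frame x u\<^sub>1 u\<^sub>2 \<kappa>\<^sub>1 \<kappa>\<^sub>2"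
    obtain p where p: "p \<in> U" "x = \<phi> p" "\<phi> p $ 2 > 0" using x by (auto simp: chart_interior_def)
    have "mean_curvature A \<psi> N p = (\<kappa>\<^sub>1 + \<kappa>\<^sub>2) / 2"
      using mean_curvature_principal_frame[OF c p(1,3)] fr p(2) by simp
    moreover have "p \<in> topspace M" using chart_props(4)[OF c] p by auto
    moreover have "(N \<circ> inv_into U \<phi>) x = N p" using p chart_props(3)[OF c] by simp
    ultimately show "\<kappa>\<^sub>1 + \<kappa>\<^sub>2 = 2 * ((N \<circ> inv_into U \<phi>) x \<bullet> w + l)"
      using translator_eq[of p] by (simp add: field_simps)
  qed (rule unit_w)
qed

text \<open>Near the edge of the half-plane the maximum principle is applied in the open half-ball \<open>B\<close> only: there
  the set where the maximum is attained is open by the maximum principle, and closed, so it is all of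
  \<open>B\<close>; continuity extends the conclusion to the points on the edge.\<close>

lemma maximum_fills_half_ball:
  assumes c: "(U, \<phi>) \<in> A" and v: "norm v = 1" "0 \<le> l" "l \<le> w \<bullet> v"
    and y: "y \<in> half_plane" and r: "r > 0" "ball y r \<inter> half_plane \<subseteq> \<phi> ` U"
    and max: "\<And>q. q \<in> topspace M \<Longrightarrow> \<psi> q \<bullet> v \<le> m"
    and q: "q \<in> U" "\<phi> q \<in> ball y r" "\<phi> q $ 2 > 0" "\<psi> q \<bullet> v = m"
    and q': "q' \<in> U" "\<phi> q' \<in> ball y r"
  shows "\<psi> q' \<bullet> v = m"
proof -
  interpret translator_patch "chart_interior (U, \<phi>)" "\<psi> \<circ> inv_into U \<phi>" "N \<circ> inv_into U \<phi>" w l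
    by (rule translating_patch[OF c])
  define f where "f x = (\<psi> \<circ> inv_into U \<phi>) x \<bullet> v" for x
  define H where "H = ball y r \<inter> half_plane"
  define B where "B = ball y r \<inter> {x. x $ 2 > 0}"
  define Y where "Y = {x \<in> B. f x = m}"
  have BH: "B \<subseteq> H" by (auto simp: B_def H_def half_plane_def)
  have Bc: "B \<subseteq> chart_interior (U, \<phi>)" using BH r by (auto simp: B_def H_def chart_interior_def)
  have oB: "open B" unfolding B_def by (intro open_Int open_ball open_upper_half)
  have fq: "f (\<phi> p) = \<psi> p \<bullet> v" if "p \<in> U" for p
    using that chart_props(3)[OF c] by (simp add: f_def)
  have fm: "f x \<le> m" if "x \<in> chart_interior (U, \<phi>)" for x
    using that max fq chart_props(4)[OF c] by (auto simp: chart_interior_def)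
  have "continuous_on (\<phi> ` U) (\<psi> \<circ> inv_into U \<phi>)"
    by (intro smooth_on_imp_continuous_on smooth_map_chart[OF smooth_\<psi> c])
  then have "continuous_on (\<phi> ` U) f" unfolding f_def by (intro continuous_intros)
  then have cf: "continuous_on H f" using r by (auto simp: H_def intro: continuous_on_subset)
  have "openin (top_of_set B) Y"
  proof -
    have "\<exists>e>0. ball x e \<subseteq> Y" if x: "x \<in> Y" for x
    proof -
      have xc: "x \<in> chart_interior (U, \<phi>)" using x Bc by (auto simp: Y_def)
      have "\<exists>e>0. ball x e \<subseteq> chart_interior (U, \<phi>) \<and> (\<forall>z\<in>ball x e. f z = f x)"
        unfolding f_def
        by (rule height_strong_maximum_principle[OF xc v]) (use fm x in \<open>simp add: f_def Y_def\<close>)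
      then obtain e where e: "e > 0" "\<And>z. z \<in> ball x e \<Longrightarrow> f z = f x" by blast
      have "x \<in> B" using x by (simp add: Y_def)
      then obtain d where d: "d > 0" "ball x d \<subseteq> B" using oB open_contains_ball by blast
      have fx: "f x = m" using x by (simp add: Y_def)
      have "z \<in> Y" if "z \<in> ball x (min d e)" for z
        using that d(2) e(2)[of z] fx by (auto simp: Y_def)
      then show ?thesis using d(1) e(1) by (metis min_less_iff_conj subsetI)
    qed
    then have "open Y" by (simp add: open_contains_ball)
    then show ?thesis by (rule open_openin_trans[OF oB]) (auto simp: Y_def)
  qed
  moreover have "closedin (top_of_set B) Y"
    unfolding Y_def by (rule continuous_closedin_preimage_constant[OF continuous_on_subset[OF cf BH]])
  moreover have "connected B"
    unfolding B_def by (intro convex_connected convex_Int convex_ball)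
       (use convex_halfspace_gt[of 0 "axis (2::2) (1::real)"] in \<open>simp add: inner_axis'\<close>)
  moreover have "\<phi> q \<in> Y" using q fq by (auto simp: Y_def B_def)
  ultimately have YB: "Y = B" unfolding connected_clopen by blast
  have "closedin (top_of_set H) {x \<in> H. f x = m}"
    by (rule continuous_closedin_preimage_constant[OF cf])
  then obtain C where C: "closed C" "{x \<in> H. f x = m} = H \<inter> C" by (auto simp: closedin_closed)
  have "B \<subseteq> C" using C(2) YB BH by (auto simp: Y_def)
  then have "closure B \<subseteq> C" using C(1) by (rule closure_minimal)
  moreover have "x \<in> closure B" if x: "x \<in> H" for x
    unfolding closure_approachable
  proof (intro allI impI)
    fix e :: real assume "e > 0"
    define d where "d = min e (r - dist y x)"
    have "d > 0" using x \<open>e > 0\<close> by (auto simp: d_def H_def)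
    then have z: "x + (d / 2) *\<^sub>R axis 2 1 \<in> ball x d" "(x + (d / 2) *\<^sub>R axis 2 1) $ 2 > 0"
      using half_plane_push_up x by (auto simp: H_def)
    have "x + (d / 2) *\<^sub>R axis 2 1 \<in> B"
      using z dist_triangle[of y "x + (d / 2) *\<^sub>R axis 2 1" x] by (auto simp: B_def d_def)
    then show "\<exists>z\<in>B. dist z x < e" using z by (auto simp: dist_commute d_def)
  qed
  moreover have "\<phi> q' \<in> H" using q' chart_height_nonneg[OF c] by (simp add: H_def)
  ultimately have "\<phi> q' \<in> {x \<in> H. f x = m}" unfolding C(2) by blast
  then show ?thesis using fq[OF q'(1)] by simp
qed

lemma half_ball_neighbourhood:
  assumes "p \<in> topspace M"
  obtains U \<phi> r where "(U, \<phi>) \<in> A" "p \<in> U" "r > 0" "ball (\<phi> p) r \<inter> half_plane \<subseteq> \<phi> ` U"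
    "openin M {q \<in> U. \<phi> q \<in> ball (\<phi> p) r}"
proof -
  obtain U \<phi> where c: "(U, \<phi>) \<in> A" "p \<in> U" using chart_exists[OF assms] .
  obtain T where T: "open T" "\<phi> ` U = half_plane \<inter> T" using chart_props(2)[OF c(1)] by (auto simp: openin_open)
  have "\<phi> p \<in> T" using T c by auto
  then obtain r where r: "r > 0" "ball (\<phi> p) r \<subseteq> T" using T open_contains_ball by blast
  have cont: "continuous_map (subtopology M U) (top_of_set (\<phi> ` U)) \<phi>"
    using chart_props(5)[OF c(1)] homeomorphic_imp_continuous_map by blast
  have "openin (top_of_set (\<phi> ` U)) (\<phi> ` U \<inter> ball (\<phi> p) r)" by (simp add: openin_open_Int)
  from openin_continuous_map_preimage[OF cont this]
  have "openin (subtopology M U) {q \<in> topspace (subtopology M U). \<phi> q \<in> \<phi> ` U \<inter> ball (\<phi> p) r}" .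
  moreover have "{q \<in> topspace (subtopology M U). \<phi> q \<in> \<phi> ` U \<inter> ball (\<phi> p) r} = {q \<in> U. \<phi> q \<in> ball (\<phi> p) r}"
    using chart_props(4)[OF c(1)] by auto
  ultimately have "openin M {q \<in> U. \<phi> q \<in> ball (\<phi> p) r}"
    using openin_open_subtopology[OF chart_props(1)[OF c(1)]] by simp
  then show ?thesis using that[OF c r(1)] r(2) T by blast
qed

text \<open>The set \<open>W\<close> of points near which the height is maximal is open by definition. A point in its closure
  has a half-ball neighbourhood that meets the open set \<open>W\<close>, hence also meets it in an interior point, and
  \<open>maximum_fills_half_ball\<close> applies. Working with neighbourhoods of all points, including those on the
  boundary, avoids showing that the interior of a connected surface is connected.\<close>

lemma interior_maximum_constant:
  assumes v: "norm v = 1" "0 \<le> l" "l \<le> w \<bullet> v"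
    and p: "p \<in> surface_interior M A"
    and max: "\<And>q. q \<in> topspace M \<Longrightarrow> \<psi> q \<bullet> v \<le> \<psi> p \<bullet> v"
    and q: "q \<in> topspace M"
  shows "\<psi> q \<bullet> v = \<psi> p \<bullet> v"
proof -
  define W where "W = {q \<in> topspace M. \<exists>G. openin M G \<and> q \<in> G \<and> (\<forall>q'\<in>G. \<psi> q' \<bullet> v = \<psi> p \<bullet> v)}"
  have pM: "p \<in> topspace M" using p by (simp add: surface_interior_def)
  have "openin M W"
  proof (subst openin_subopen, intro ballI)
    fix x assume "x \<in> W"
    then obtain G where G: "openin M G" "x \<in> G" "\<forall>q'\<in>G. \<psi> q' \<bullet> v = \<psi> p \<bullet> v" by (auto simp: W_def)
    then have "G \<subseteq> W" using openin_subset[OF G(1)] by (auto simp: W_def)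
    then show "\<exists>T. openin M T \<and> x \<in> T \<and> T \<subseteq> W" using G by blast
  qed
  moreover have "closedin M W"
  proof -
    have "x \<in> W" if x: "x \<in> M closure_of W" for x
    proof -
      have xM: "x \<in> topspace M" using x by (simp add: in_closure_of)
      obtain U \<phi> r where c: "(U, \<phi>) \<in> A" "x \<in> U" "r > 0" "ball (\<phi> x) r \<inter> half_plane \<subseteq> \<phi> ` U"
        and o: "openin M {q \<in> U. \<phi> q \<in> ball (\<phi> x) r}"
        using half_ball_neighbourhood[OF xM] .
      define G where "G = {q \<in> U. \<phi> q \<in> ball (\<phi> x) r}"
      have oG: "openin M G" using o by (simp only: G_def)
      have "x \<in> G" using c(2,3) by (simp add: G_def)
      then obtain z where "z \<in> W" "z \<in> G" using x oG unfolding in_closure_of by blast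
      then obtain G' where G': "openin M G'" "z \<in> G'" "\<forall>q'\<in>G'. \<psi> q' \<bullet> v = \<psi> p \<bullet> v" by (auto simp: W_def)
      have "openin M (G \<inter> G')" using oG G'(1) by (rule openin_Int)
      then obtain q0 where q0: "q0 \<in> G \<inter> G'" "\<phi> q0 $ 2 > 0"
        using open_set_meets_interior[OF c(1), of "G \<inter> G'"] \<open>z \<in> G\<close> G'(2) by (auto simp: G_def)
      have "\<psi> q' \<bullet> v = \<psi> p \<bullet> v" if "q' \<in> G" for q'
        by (rule maximum_fills_half_ball[OF c(1) v chart_height_nonneg[OF c(1,2)] c(3,4) max, where q=q0])
           (use q0 that G' in \<open>auto simp: G_def\<close>)
      then show "x \<in> W" using xM oG \<open>x \<in> G\<close> unfolding W_def by blast
    qed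
    then show ?thesis by (metis closure_of_subset_eq openin_subset[OF calculation] subsetI)
  qed
  moreover have "p \<in> W"
  proof -
    obtain U \<phi> r where c: "(U, \<phi>) \<in> A" "p \<in> U" "r > 0" "ball (\<phi> p) r \<inter> half_plane \<subseteq> \<phi> ` U"
      and o: "openin M {q \<in> U. \<phi> q \<in> ball (\<phi> p) r}"
      using half_ball_neighbourhood[OF pM] .
    define G where "G = {q \<in> U. \<phi> q \<in> ball (\<phi> p) r}"
    have oG: "openin M G" using o by (simp only: G_def)
    have pG: "p \<in> G" using c(2,3) by (simp add: G_def)
    have pos: "\<phi> p $ 2 > 0" using surface_interior_iff[OF c(1,2)] p by simp
    have "\<psi> q' \<bullet> v = \<psi> p \<bullet> v" if "q' \<in> G" for q'
      by (rule maximum_fills_half_ball[OF c(1) v chart_height_nonneg[OF c(1,2)] c(3,4) max, where q=p])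
         (use that pG pos in \<open>auto simp: G_def\<close>)
    then show ?thesis using pM oG pG unfolding W_def by blast
  qed
  moreover have "connected_space M" using oriented by (simp add: oriented_immersed_surface_def)
  ultimately have "W = topspace M" unfolding connected_space_clopen_in by blast
  then show ?thesis using q openin_subset by (auto simp: W_def)
qed

text \<open>All derivatives of the height vanish, and \<open>height_equation\<close> leaves \<open>\<langle>w, v\<rangle> = - l \<langle>N, v\<rangle> \<le> l\<close>.\<close>

lemma constant_height_forces_equality:
  assumes v: "norm v = 1" "0 \<le> l" "l \<le> w \<bullet> v"
    and const: "\<And>q. q \<in> topspace M \<Longrightarrow> \<psi> q \<bullet> v = m"
  shows "w \<bullet> v = l"
proof -
  obtain p where p: "p \<in> surface_interior M A" using surface_interior_nonempty by blast
  then have pM: "p \<in> topspace M" by (simp add: surface_interior_def)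
  then obtain U \<phi> where c: "(U, \<phi>) \<in> A" "p \<in> U" using chart_exists by blast
  interpret translator_patch "chart_interior (U, \<phi>)" "\<psi> \<circ> inv_into U \<phi>" "N \<circ> inv_into U \<phi>" w l
    by (rule translating_patch[OF c(1)])
  define X where "X = \<psi> \<circ> inv_into U \<phi>"
  have "\<phi> p $ 2 > 0" using surface_interior_iff[OF c] p by simp
  then have x: "\<phi> p \<in> chart_interior (U, \<phi>)" using c by (auto simp: chart_interior_def)
  have inv: "inv_into U \<phi> (\<phi> q) = q" if "q \<in> U" for q using that chart_props(3)[OF c(1)] by simp
  have Xm: "X y \<bullet> v = m" if "y \<in> chart_interior (U, \<phi>)" for y
    using that const chart_props(4)[OF c(1)] inv by (auto simp: chart_interior_def X_def)
  have d1: "dderiv u X y \<bullet> v = 0" if y: "y \<in> chart_interior (U, \<phi>)" for u y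
    by (rule derivative_of_constant_function[OF y has_derivative_inner_left[OF X_derivs(1)[OF y]], folded X_def, OF Xm])
  have d2: "dderiv a (dderiv u X) y \<bullet> v = 0" if y: "y \<in> chart_interior (U, \<phi>)" for u a y
    by (rule derivative_of_constant_function[OF y has_derivative_inner_left[OF X_derivs(2)[OF y]], folded X_def, OF d1])
  obtain u\<^sub>1 u\<^sub>2 \<kappa>\<^sub>1 \<kappa>\<^sub>2 where fr: "principal_frame (\<phi> p) u\<^sub>1 u\<^sub>2 \<kappa>\<^sub>1 \<kappa>\<^sub>2" using ex_principal_frame[OF x] .
  have eq: "w \<bullet> v + l * (N p \<bullet> v) = 0"
    using height_equation[OF x fr, of v, folded X_def] inv[OF c(2)] by (simp add: d1[OF x] d2[OF x] inner_add_left)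
  have "\<bar>N p \<bullet> v\<bar> \<le> 1" using Cauchy_Schwarz_ineq2[of "N p" v] unit_normal[OF x] v inv[OF c(2)] by simp
  then have "l * (- (N p \<bullet> v)) \<le> l * 1" using v by (intro mult_left_mono) auto
  then show ?thesis using eq v by simp
qed

text \<open>If the maximum of the height is attained in the interior, the height is constant, so the surface is planar
  and \<open>planar_boundary_in_plane\<close> applies. Otherwise the maximum lies on the boundary, where the height is \<open>0\<close>.\<close>

lemma height_dichotomy:
  assumes cpt: "compact_space M" and v: "norm v = 1" "0 \<le> l" "l \<le> w \<bullet> v"
    and bd: "\<psi> ` surface_boundary A \<subseteq> {x. x \<bullet> v = 0}"
  shows "(\<forall>p\<in>surface_interior M A. \<psi> p \<bullet> v < 0) \<or> (w \<bullet> v = l \<and> (\<forall>p\<in>topspace M. \<psi> p \<bullet> v = 0))"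
proof -
  obtain p where p: "p \<in> topspace M" "\<And>q. q \<in> topspace M \<Longrightarrow> \<psi> q \<bullet> v \<le> \<psi> p \<bullet> v"
    using height_attains_max[OF cpt] by blast
  show ?thesis
  proof (cases "\<exists>p0\<in>surface_interior M A. \<psi> p0 \<bullet> v = \<psi> p \<bullet> v")
    case True
    then obtain p0 where p0: "p0 \<in> surface_interior M A" "\<psi> p0 \<bullet> v = \<psi> p \<bullet> v" by blast
    have const: "\<psi> q \<bullet> v = \<psi> p0 \<bullet> v" if "q \<in> topspace M" for q
      by (rule interior_maximum_constant[OF v p0(1)]) (use p p0 that in auto)
    have "w \<bullet> v = l" by (rule constant_height_forces_equality[OF v const])
    moreover have "\<psi> q \<bullet> v = 0" if "q \<in> topspace M" for q
      by (rule planar_boundary_in_plane[OF cpt _ _ _ bd that, of v "\<psi> p0 \<bullet> v"]) (use const v in auto)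
    ultimately show ?thesis by blast
  next
    case False
    then have "p \<notin> surface_interior M A" by blast
    then have "\<psi> p \<bullet> v = 0" using bd p(1) by (auto simp: surface_interior_def)
    have "\<psi> q \<bullet> v < 0" if q: "q \<in> surface_interior M A" for q
    proof -
      have "\<psi> q \<bullet> v \<noteq> \<psi> p \<bullet> v" using False q by blast
      moreover have "\<psi> q \<bullet> v \<le> \<psi> p \<bullet> v" by (rule p(2)) (use q in \<open>simp add: surface_interior_def\<close>)
      ultimately show ?thesis using \<open>\<psi> p \<bullet> v = 0\<close> by linarith
    qed
    then show ?thesis by blast
  qed
qed

end

theorem corollary4p4:
  fixes l :: real and v w :: "real^3"
    and M :: "'a topology" and A :: "'a chart set" and \<psi> N :: "'a \<Rightarrow> real^3"
  assumes "0 \<le> l" and "l \<le> 1"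
    and "w \<in> sphere 0 1" and "v \<in> sphere 0 1"
    and "translator l w M A \<psi> N" and "compact_space M"
    and "\<psi> ` surface_boundary A \<subseteq> {x. x \<bullet> v = 0}"
    and "\<bar>v \<bullet> w\<bar> \<ge> l"
  shows "\<psi> ` surface_interior M A \<subseteq> {x. sgn (v \<bullet> w) * (x \<bullet> v) \<le> 0} \<and>
    (\<psi> ` surface_interior M A \<inter> {x. x \<bullet> v = 0} \<noteq> {} \<longleftrightarrow> planar M \<psi> \<and> \<bar>v \<bullet> w\<bar> = l)"
proof -
  interpret translating_surface M A \<psi> N w l
    using assms by unfold_locales (auto simp: translator_def)
  \<comment> \<open>If \<open>\<langle>v, w\<rangle> = 0\<close> then also \<open>l = 0\<close>, so either sign satisfies the hypotheses of \<open>height_dichotomy\<close>.\<close>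
  define \<sigma> :: real where "\<sigma> = (if v \<bullet> w < 0 then - 1 else 1)"
  have \<sigma>: "\<sigma> = 1 \<or> \<sigma> = - 1" and abs: "\<bar>v \<bullet> w\<bar> = w \<bullet> (\<sigma> *\<^sub>R v)"
    by (auto simp: \<sigma>_def inner_commute)
  have v: "norm v = 1" "norm (\<sigma> *\<^sub>R v) = 1" "v \<noteq> 0" using assms \<sigma> by auto
  have bd: "\<psi> ` surface_boundary A \<subseteq> {x. x \<bullet> (\<sigma> *\<^sub>R v) = 0}" using assms(7) by auto
  have dich: "(\<forall>p\<in>surface_interior M A. \<psi> p \<bullet> (\<sigma> *\<^sub>R v) < 0) \<or>
      (\<bar>v \<bullet> w\<bar> = l \<and> (\<forall>p\<in>topspace M. \<psi> p \<bullet> v = 0))"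
    using height_dichotomy[OF assms(6) v(2) assms(1) _ bd] assms(8) \<sigma> unfolding abs by auto
  have int: "surface_interior M A \<subseteq> topspace M" by (auto simp: surface_interior_def)
  have "sgn (v \<bullet> w) * (\<psi> p \<bullet> v) \<le> 0" if p: "p \<in> surface_interior M A" for p
  proof (cases "v \<bullet> w = 0")
    case False
    then have "sgn (v \<bullet> w) = \<sigma>" by (auto simp: \<sigma>_def sgn_if)
    moreover have "\<psi> p \<bullet> (\<sigma> *\<^sub>R v) \<le> 0" using dich p int \<sigma> by force
    ultimately show ?thesis by simp
  qed simp
  moreover have "planar M \<psi> \<and> \<bar>v \<bullet> w\<bar> = l" if meet: "\<psi> ` surface_interior M A \<inter> {x. x \<bullet> v = 0} \<noteq> {}"
  proof -
    obtain p where "p \<in> surface_interior M A" "\<psi> p \<bullet> v = 0" using meet by auto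
    then have "\<bar>v \<bullet> w\<bar> = l" "\<forall>p\<in>topspace M. \<psi> p \<bullet> v = 0" using dich by fastforce+
    moreover from this(2) have "planar M \<psi>"
      unfolding planar_def using v(3) by (intro exI[of _ v] exI[of _ 0]) auto
    ultimately show ?thesis by blast
  qed
  moreover have "\<psi> ` surface_interior M A \<inter> {x. x \<bullet> v = 0} \<noteq> {}" if pl: "planar M \<psi>"
  proof -
    obtain n b where n: "n \<noteq> 0" "\<psi> ` topspace M \<subseteq> {x. x \<bullet> n = b}" using pl unfolding planar_def by blast
    obtain p where "p \<in> surface_interior M A" using surface_interior_nonempty by blast
    moreover from this have "\<psi> p \<bullet> v = 0"
      using planar_boundary_in_plane[OF assms(6) n v(3) assms(7)] int by blast
    ultimately show ?thesis by blast
  qed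
  ultimately show ?thesis by blast
qed

end
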